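(* The density $m_{a,c}(t)$ is continuously differentiable in its parameters $(a,c)\in\Omega$, locally uniformly for $t$ in compact intervals of $[0,\infty)$, with the $c$-derivative understood from the right at $c=0$. For $(a,c)\in\Omega$ and $t\ge 0$, $$\partial_a m_{a,c}=k-k*m_{a,c},\qquad \partial_c m_{a,c}=j-j*m_{a,c},$$ and $$t\,m_{a,c}(t)=Q_{a,c}(t)-(Q_{a,c}*m_{a,c})(t).$$
   Context: $\Omega=\{(a,c): a>0,\ 0\le c<1,\ a+c<3\}$. For $(a,c)\in\Omega$ put $$w_{a,c}(s)=\frac1\pi\left(\frac{s}{1-s}\right)^{as+c}\sin\bigl(\pi(as+c)\bigr)\quad(0<s<1),$$ $$q_1=\frac a2+c,\qquad q_2=\frac a3+\frac c2+\frac12\left(\frac a2+c\right)^2,$$ $$D_{a,c}(t)=q_1+(q_1-q_2)t+e^{-a}\int_0^1 w_{a,c}(s)\bigl[e^{(1-s)t}-1-(1-s)t\bigr]\,ds,$$ and $m_{a,c}(t)=e^{-t}D_{a,c}(t)$. For locally integrable functions on $[0,\infty)$, $(f*g)(t)=\int_0^t f(t-s)g(s)\,ds$. Define, for $t>0$, $$k(t)=\int_0^1 re^{-rt}\,dr=\frac{1-(1+t)e^{-t}}{t^2},\qquad j(t)=\int_0^1 e^{-rt}\,dr=\frac{1-e^{-t}}{t},$$ $$Q_{a,c}(t)=t\,[a k(t)+c j(t)]=a t k(t)+c(1-e^{-t}),$$ with the removable singularities at $t=0$ filled in by $k(0)=1/2$, $j(0)=1$ (so $Q_{a,c}(0)=0$).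 *)

theory Defs
  imports "HOL-Analysis.Analysis"
begin

definition param_dom :: "(real \<times> real) set" where
  "param_dom = {(a, c). a > 0 \<and> 0 \<le> c \<and> c < 1 \<and> a + c < 3}"

text \<open>Only the values on \<open>0 < s < 1\<close> are used; there the base \<open>s / (1 - s)\<close> is positive, so that
  \<open>powr\<close> is the usual real power.\<close>

definition wfun :: "real \<Rightarrow> real \<Rightarrow> real \<Rightarrow> real" where
  "wfun a c s = (1 / pi) * (s / (1 - s)) powr (a * s + c) * sin (pi * (a * s + c))"

definition q1 :: "real \<Rightarrow> real \<Rightarrow> real" where
  "q1 a c = a / 2 + c"

definition q2 :: "real \<Rightarrow> real \<Rightarrow> real" where
  "q2 a c = a / 3 + c / 2 + (1 / 2) * (a / 2 + c)\<^sup>2"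

definition Dfun :: "real \<Rightarrow> real \<Rightarrow> real \<Rightarrow> real" where
  "Dfun a c t = q1 a c + (q1 a c - q2 a c) * t
     + exp (- a) * (LBINT s:{0<..<1}. wfun a c s * (exp ((1 - s) * t) - 1 - (1 - s) * t))"

definition mfun :: "real \<Rightarrow> real \<Rightarrow> real \<Rightarrow> real" where
  "mfun a c t = exp (- t) * Dfun a c t"

definition conv :: "(real \<Rightarrow> real) \<Rightarrow> (real \<Rightarrow> real) \<Rightarrow> real \<Rightarrow> real" where
  "conv f g t = (LBINT s:{0..t}. f (t - s) * g s)"

text \<open>The integral formulas below also give the values of the continuous extensions at \<open>t = 0\<close>;
  the closed forms for \<open>t > 0\<close> and the values at \<open>0\<close> are proved after the definitions.\<close>

definition kfun :: "real \<Rightarrow> real" where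
  "kfun t = (LBINT r:{0..1}. r * exp (- r * t))"

definition jfun :: "real \<Rightarrow> real" where
  "jfun t = (LBINT r:{0..1}. exp (- r * t))"

definition Qfun :: "real \<Rightarrow> real \<Rightarrow> real \<Rightarrow> real" where
  "Qfun a c t = t * (a * kfun t + c * jfun t)"

lemma LBINT_unit_interval_FTC:
  fixes F f :: "real \<Rightarrow> real"
  assumes "\<And>r. (F has_real_derivative f r) (at r)" and "continuous_on {0..1} f"
  shows "(LBINT r:{0..1}. f r) = F 1 - F 0"
proof -
  have "set_integrable lborel {0..1} f"
    using borel_integrable_compact[OF _ assms(2)]
    by (simp add: set_integrable_def indicator_scaleR_eq_if)
  then have "(LBINT r:{0..1}. f r) = integral {0..1} f"
    by (rule set_borel_integral_eq_integral)
  moreover have "(f has_integral (F 1 - F 0)) {0..1}"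
    by (rule fundamental_theorem_of_calculus)
      (auto intro: has_field_derivative_at_within assms(1)
        simp flip: has_real_derivative_iff_has_vector_derivative)
  ultimately show ?thesis
    by (simp add: integral_unique)
qed

lemma kfun_0: "kfun 0 = 1 / 2"
  unfolding kfun_def
  by (subst LBINT_unit_interval_FTC[where F = "\<lambda>r. r\<^sup>2 / 2"])
    (auto intro!: derivative_eq_intros continuous_intros)

lemma jfun_0: "jfun 0 = 1"
  unfolding jfun_def
  by (subst LBINT_unit_interval_FTC[where F = "\<lambda>r. r"])
    (auto intro!: derivative_eq_intros continuous_intros)

lemma kfun_closed_form:
  assumes "t > 0"
  shows "kfun t = (1 - (1 + t) * exp (- t)) / t\<^sup>2"
  unfolding kfun_def using assms
  by (subst LBINT_unit_interval_FTC[where F = "\<lambda>r. - (1 + r * t) * exp (- r * t) / t\<^sup>2"])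
    (auto intro!: derivative_eq_intros continuous_intros
      simp: field_simps power2_eq_square)

lemma jfun_closed_form:
  assumes "t > 0"
  shows "jfun t = (1 - exp (- t)) / t"
  unfolding jfun_def using assms
  by (subst LBINT_unit_interval_FTC[where F = "\<lambda>r. - exp (- r * t) / t"])
    (auto intro!: derivative_eq_intros continuous_intros simp: field_simps)

text \<open>Continuous differentiability of \<open>(a, c) \<mapsto> F a c\<close> on \<open>S\<close>, uniformly for \<open>t\<close> in compact intervals
  \<open>{0..T}\<close>: the difference quotients in \<open>a\<close> and in \<open>c\<close> converge uniformly in \<open>t\<close> to partial
  derivatives \<open>Fa\<close>, \<open>Fc\<close>, which depend continuously on \<open>(a, c)\<close>, uniformly in \<open>t\<close>.  The limits are
  taken within the slices of \<open>S\<close>.  For \<open>S = param_dom\<close> the \<open>a\<close>-slices are open, and a \<open>c\<close>-slice is a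
  half-open interval with left end point \<open>0\<close> included, so that only the \<open>c\<close>-derivative at \<open>c = 0\<close> is
  one-sided, namely from the right.\<close>

definition C1_in_params_loc_unif ::
  "(real \<times> real) set \<Rightarrow> (real \<Rightarrow> real \<Rightarrow> real \<Rightarrow> real) \<Rightarrow> bool" where
  "C1_in_params_loc_unif S F \<longleftrightarrow>
    (\<exists>Fa Fc :: real \<Rightarrow> real \<Rightarrow> real \<Rightarrow> real. \<forall>T\<ge>0. \<forall>(a, c)\<in>S.
       uniform_limit {0..T} (\<lambda>a' t. (F a' c t - F a c t) / (a' - a)) (Fa a c)
         (at a within {a'. (a', c) \<in> S}) \<and>
       uniform_limit {0..T} (\<lambda>c' t. (F a c' t - F a c t) / (c' - c)) (Fc a c)
         (at c within {c'. (a, c') \<in> S}) \<and>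
       uniform_limit {0..T} (\<lambda>(a', c'). Fa a' c') (Fa a c) (at (a, c) within S) \<and>
       uniform_limit {0..T} (\<lambda>(a', c'). Fc a' c') (Fc a c) (at (a, c) within S))"

end

theory Submission
  imports Defs
begin

unbundle no vec_syntax
unbundle fps_syntax

text \<open>
  Write \<open>D(t) = \<Sum> d\<^sub>n t\<^sup>n / n!\<close> and attach to such a function the formal power series
  \<open>\<Sum> d\<^sub>n X\<^sup>n\<close>.  Since the convolution of \<open>t\<^sup>i / i!\<close> and \<open>t\<^sup>j / j!\<close> is
  \<open>t\<^sup>i\<^sup>+\<^sup>j\<^sup>+\<^sup>1 / (i + j + 1)!\<close>, convolution becomes \<open>X\<close> times the product of power series,
  multiplication by \<open>t\<close> becomes \<open>f \<mapsto> X (X f)'\<close>, and the weight \<open>e\<^sup>-\<^sup>t\<close>, carried by \<open>m\<close>, \<open>k\<close> and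
  \<open>j\<close> alike, passes through convolutions.  Times \<open>X\<close>, the series of \<open>e\<^sup>t k\<close> and \<open>e\<^sup>t j\<close> are
  \<open>K = \<Sum> X\<^sup>n / (n (n + 1))\<close> and \<open>J = \<Sum> X\<^sup>n / n = - log (1 - X)\<close>.  The heart of the matter is that
  the series \<open>d\<close> of \<open>D\<^bsub>a,c\<^esub>\<close> satisfies
    \<open>1 - X d = G\<close>, where \<open>G = exp (- (a K + c J))\<close>  (lemma \<open>Dfun_eq_egf\<close>).
  Granted this, \<open>\<partial>\<^sub>a G = - K G\<close>, \<open>\<partial>\<^sub>c G = - J G\<close> and \<open>G' = - (a K' + c J') G\<close> are the three
  claimed formulas, read coefficient by coefficient; as the coefficients of \<open>G\<close> grow at most
  geometrically, locally uniformly in \<open>(a, c)\<close>, all the series may be differentiated term by term, and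
  second derivatives are bounded, which makes the convergence uniform for \<open>t\<close> in compact intervals.

  For the formula for \<open>d\<close> one must evaluate the moments of \<open>w\<close>: for \<open>N \<ge> 3\<close>,
    \<open>\<integral> w(s) (1 - s)\<^sup>N\<^sup>-\<^sup>1 ds = - e\<^sup>a [X\<^sup>N] G\<close>  (lemma \<open>LBINT_wfun_moment\<close>);
  the coefficients \<open>d\<^sub>0\<close> and \<open>d\<^sub>1\<close> are the explicit terms with \<open>q\<^sub>1\<close> and \<open>q\<^sub>2\<close>.  This is a Cauchy
  integral for \<open>G\<close> deformed onto the cut \<open>[1, \<infinity>)\<close>, but contours can be avoided.  With
  \<open>L = log (s / (1 - s))\<close>, the function \<open>w\<close> is \<open>1 / \<pi>\<close> times the imaginary part of
  \<open>exp ((a s + c) (L + i \<pi>))\<close>.  Expanding in powers of \<open>a\<close> produces the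
  imaginary parts of the integrals of
  \<open>s\<^sup>k (1 - s)\<^sup>N\<^sup>-\<^sup>1 exp (c (L + i \<pi>)) (L + i \<pi>)\<^sup>k / k!\<close>, which are the \<open>k\<close>-th Taylor
  coefficients in \<open>c\<close> of \<open>sin (\<pi> c) Beta (c + k + 1) (N - c)\<close>.  The
  reflection formula turns the latter into a polynomial in \<open>c\<close>, namely, up to sign and a factor
  \<open>\<pi>\<close>, the coefficient of \<open>X\<^sup>N\<^sup>+\<^sup>k\<close> in \<open>(1 - X)\<^sup>c\<^sup>+\<^sup>k = exp (- (c + k) J)\<close>; its \<open>k\<close>-th Taylor
  coefficient in \<open>c\<close> is therefore, up to sign, the coefficient of \<open>X\<^sup>N\<^sup>+\<^sup>k\<close> in
  \<open>J\<^sup>k (1 - X)\<^sup>c\<^sup>+\<^sup>k / k!\<close>.  Because \<open>(1 - X) J = X (1 - K)\<close>, this is the coefficient of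
  \<open>X\<^sup>N\<close> in \<open>(1 - K)\<^sup>k exp (- c J) / k!\<close>.  All signs combine to a
  single minus, and summing over \<open>k\<close> against \<open>a\<^sup>k\<close> gives \<open>exp (a (1 - K) - c J) = e\<^sup>a G\<close>.
\<close>

section \<open>Exponentials of formal power series\<close>

lemma fps_linear_ODE_unique:
  fixes F G H :: "real fps"
  assumes F: "fps_deriv F = H * F" and G: "fps_deriv G = H * G" and 0: "F $ 0 = G $ 0"
  shows "F = G"
proof -
  define D where "D = F - G"
  have D: "fps_deriv D = H * D" using F G by (simp add: D_def algebra_simps)
  have "D $ n = 0" for n
  proof (induction n rule: less_induct)
    case (less n)
    show ?case
    proof (cases n)
      case 0 then show ?thesis using assms(3) by (simp add: D_def)
    next
      case (Suc m)
      have "of_nat (Suc m) * D $ Suc m = (H * D) $ m" by (simp flip: D)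
      also have "\<dots> = 0" by (auto simp: fps_mult_nth Suc intro!: sum.neutral less)
      finally show ?thesis using Suc by simp
    qed
  qed
  then show ?thesis by (simp add: D_def fps_eq_iff)
qed

definition fexp :: "real fps \<Rightarrow> real fps" where
  "fexp U = fps_exp 1 oo U"

lemma fexp_nth_0 [simp]: "fexp U $ 0 = 1"
  by (simp add: fexp_def)

lemma fps_deriv_fexp:
  assumes "U $ 0 = 0"
  shows "fps_deriv (fexp U) = fps_deriv U * fexp U"
  using assms by (simp add: fexp_def fps_compose_deriv mult.commute)

lemma fexp_unique:
  assumes "U $ 0 = 0" "fps_deriv F = fps_deriv U * F" "F $ 0 = 1"
  shows "fexp U = F"
  using fps_linear_ODE_unique[OF fps_deriv_fexp[OF assms(1)] assms(2)] assms(3) by simp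

lemma fexp_add:
  assumes "U $ 0 = 0" "V $ 0 = 0"
  shows "fexp (U + V) = fexp U * fexp V"
  by (rule fexp_unique)
    (use assms in \<open>simp_all add: fps_deriv_fexp algebra_simps\<close>)

lemma fexp_scale_nth:
  assumes "U $ 0 = 0"
  shows "fexp (fps_const x * U) $ n = (\<Sum>i\<le>n. x ^ i / fact i * (U ^ i) $ n)"
  by (simp add: fexp_def fps_compose_nth power_mult_distrib fps_const_power atLeast0AtMost)

text \<open>As \<open>U\<close> has no constant term, each coefficient involves only finitely many powers of \<open>U\<close>; it is a
  polynomial in the scalar \<open>x\<close>.\<close>

lemma fexp_scale_mult_nth:
  assumes "U $ 0 = 0"
  shows "(fexp (fps_const x * U) * W) $ n = (\<Sum>i\<le>n. x ^ i / fact i * (U ^ i * W) $ n)"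
proof -
  have *: "fexp (fps_const x * U) $ l = (\<Sum>i\<le>n. x ^ i / fact i * (U ^ i) $ l)" if "l \<le> n" for l
    unfolding fexp_scale_nth[OF assms]
    by (rule sum.mono_neutral_left) (use that assms in \<open>auto simp: startsby_zero_power_prefix\<close>)
  have "(fexp (fps_const x * U) * W) $ n
      = (\<Sum>l\<le>n. \<Sum>i\<le>n. x ^ i / fact i * (U ^ i) $ l * W $ (n - l))"
    by (simp add: fps_mult_nth atLeast0AtMost * sum_distrib_right)
  also have "\<dots> = (\<Sum>i\<le>n. \<Sum>l\<le>n. x ^ i / fact i * (U ^ i) $ l * W $ (n - l))"
    by (rule sum.swap)
  also have "\<dots> = (\<Sum>i\<le>n. x ^ i / fact i * (U ^ i * W) $ n)"
    by (simp add: fps_mult_nth atLeast0AtMost sum_distrib_left mult.assoc)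
  finally show ?thesis .
qed

lemma has_real_derivative_power_sum_at_0:
  fixes f :: "nat \<Rightarrow> real"
  assumes "f 1 = 0 \<or> n \<ge> 1"
  shows "((\<lambda>x. \<Sum>i\<le>n. f i * x ^ i) has_real_derivative f 1) (at 0)"
proof -
  have "((\<lambda>x. \<Sum>i\<le>n. f i * x ^ i) has_real_derivative (\<Sum>i\<le>n. f i * (of_nat i * 0 ^ (i - 1)))) (at 0)"
    by (auto intro!: derivative_eq_intros sum.cong)
  also have "(\<Sum>i\<le>n. f i * (of_nat i * 0 ^ (i - 1))) = (\<Sum>i\<in>{..n}. if i = 1 then f i else 0)"
    by (rule sum.cong) (auto simp: power_0_left)
  also have "\<dots> = f 1" using assms by auto
  finally show ?thesis .
qed

text \<open>By the functional equation it suffices to differentiate at scalar \<open>0\<close>, where the coefficient is a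
  polynomial whose linear term can be read off.\<close>

lemma has_real_derivative_fexp_nth:
  assumes "U $ 0 = 0" "V $ 0 = 0"
  shows "((\<lambda>x. fexp (V + fps_const x * U) $ n) has_real_derivative
           (U * fexp (V + fps_const x * U)) $ n) (at x)"
proof -
  define W where "W = fexp (V + fps_const x * U)"
  have shift: "fexp (V + fps_const (x + h) * U) = fexp (fps_const h * U) * W" for h
  proof -
    have "V + fps_const (x + h) * U = fps_const h * U + (V + fps_const x * U)"
      by (simp add: algebra_simps flip: fps_const_add)
    then show ?thesis unfolding W_def using assms by (simp add: fexp_add)
  qed
  have "((\<lambda>h. \<Sum>i\<le>n. (U ^ i * W) $ n / fact i * h ^ i) has_real_derivative (U ^ 1 * W) $ n / fact 1) (at 0)"
    by (rule has_real_derivative_power_sum_at_0)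
      (use assms in \<open>auto simp: not_le\<close>)
  then have "((\<lambda>h. fexp (V + fps_const (x + h) * U) $ n) has_real_derivative (U * W) $ n) (at 0)"
    unfolding shift fexp_scale_mult_nth[OF assms(1)] by (simp add: mult.commute)
  then show ?thesis
    using DERIV_shift[of "\<lambda>x. fexp (V + fps_const x * U) $ n" _ 0 x] by (simp add: W_def add.commute)
qed

text \<open>The values at \<open>0\<close> vanish because of \<open>1 / 0 = 0\<close>.  In closed form, \<open>J = - log (1 - X)\<close> and
  \<open>K = 1 + (1 / X - 1) log (1 - X)\<close>.\<close>

definition Jfps :: "real fps" where "Jfps = Abs_fps (\<lambda>n. 1 / real n)"
definition Kfps :: "real fps" where "Kfps = Abs_fps (\<lambda>n. 1 / (real n * real (Suc n)))"

lemma Jfps_nth [simp]: "Jfps $ n = 1 / real n" by (simp add: Jfps_def)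
lemma Kfps_nth [simp]: "Kfps $ n = 1 / (real n * real (Suc n))" by (simp add: Kfps_def)

lemma Jfps_Kfps: "(1 - fps_X) * Jfps = fps_X * (1 - Kfps)"
proof (rule fps_ext)
  fix n
  show "((1 - fps_X) * Jfps) $ n = (fps_X * (1 - Kfps)) $ n"
    by (cases n; cases "n - 1") (auto simp: algebra_simps field_simps)
qed

lemma fps_deriv_Jfps: "(1 - fps_X) * fps_deriv Jfps = 1"
proof (rule fps_ext)
  fix n
  show "((1 - fps_X) * fps_deriv Jfps) $ n = (1 :: real fps) $ n"
    by (cases n) (auto simp: algebra_simps)
qed

lemma one_minus_X_cancel: "(1 - fps_X) * F = (1 - fps_X) * G \<longleftrightarrow> F = (G :: real fps)"
proof -
  have "(1 - fps_X :: real fps) $ 0 \<noteq> 0" by simp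
  then have "(1 - fps_X :: real fps) \<noteq> 0" by fastforce
  then show ?thesis by (rule mult_cancel_left[THEN trans, OF disj_not1[THEN iffD1, rule_format, THEN iffD2], rotated]) auto
qed

lemma fexp_uminus_Jfps: "fexp (- Jfps) = 1 - fps_X"
proof (rule fexp_unique)
  show "fps_deriv (1 - fps_X) = fps_deriv (- Jfps) * (1 - fps_X)"
    using fps_deriv_Jfps by (simp add: mult.commute)
qed simp_all

text \<open>The binomial series of \<open>(1 - X)\<^sup>x\<close>.\<close>

lemma fexp_Jfps_nth: "fexp (fps_const (- x) * Jfps) $ n = pochhammer (- x) n / fact n"
proof -
  have "fexp (fps_const (- x) * Jfps) = Abs_fps (\<lambda>n. pochhammer (- x) n / fact n)" (is "_ = ?B")
  proof (rule fexp_unique)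
    have "(1 - fps_X) * fps_deriv ?B = fps_const (- x) * ?B"
    proof (rule fps_ext)
      fix n
      have rec: "real (Suc m) * ?B $ Suc m = (real m - x) * ?B $ m" for m
        by (simp add: pochhammer_Suc)
      show "((1 - fps_X) * fps_deriv ?B) $ n = (fps_const (- x) * ?B) $ n"
        using rec[of n] by (cases n) (auto simp add: left_diff_distrib simp del: fps_nth_Abs_fps)
    qed
    also have "\<dots> = ((1 - fps_X) * fps_deriv Jfps) * (fps_const (- x) * ?B)"
      by (simp add: fps_deriv_Jfps)
    finally have "(1 - fps_X) * fps_deriv ?B = (1 - fps_X) * (fps_deriv Jfps * (fps_const (- x) * ?B))"
      by (simp only: mult.assoc)
    then show "fps_deriv ?B = fps_deriv (fps_const (- x) * Jfps) * ?B"
      unfolding one_minus_X_cancel by (simp add: mult_ac)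
  qed simp_all
  then show ?thesis by simp
qed

section \<open>Power series and integrals\<close>

lemma powser_zero_imp_coeff_zero:
  fixes a :: "nat \<Rightarrow> real"
  assumes r: "0 < r" and 0: "\<And>x. \<bar>x\<bar> < r \<Longrightarrow> (\<lambda>n. a n * x ^ n) sums 0"
  shows "a n = 0"
proof (induction n rule: less_induct)
  case (less n)
  have "((\<lambda>x. 0) \<longlongrightarrow> a (0 + n)) (at (0 :: real))"
  proof (rule powser_limit_0_strong[OF r])
    fix x :: real assume x: "x \<noteq> 0" "norm x < r"
    have "(\<lambda>i. a (i + n) * x ^ (i + n)) sums (0 - (\<Sum>i<n. a i * x ^ i))"
      using 0[of x] x by (intro sums_split_initial_segment) auto
    also have "(\<Sum>i<n. a i * x ^ i) = 0" using less by simp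
    finally have "(\<lambda>i. a (i + n) * x ^ (i + n) / x ^ n) sums (0 / x ^ n)"
      by (intro sums_divide) simp
    then show "(\<lambda>i. a (i + n) * x ^ i) sums 0" using x by (simp add: power_add)
  qed
  then show ?case using LIM_unique[OF _ tendsto_const] by fastforce
qed

lemma set_integral_sums_dominated:
  fixes f :: "nat \<Rightarrow> real \<Rightarrow> real"
  assumes S: "S \<in> sets borel"
    and f: "\<And>n. f n \<in> borel_measurable borel"
    and F: "F \<in> borel_measurable borel"
    and g: "set_integrable lborel S g"
    and sums: "\<And>s. s \<in> S \<Longrightarrow> (\<lambda>n. f n s) sums F s"
    and bound: "\<And>s n. s \<in> S \<Longrightarrow> (\<Sum>i<n. \<bar>f i s\<bar>) \<le> g s"
  shows "(\<lambda>n. LBINT s:S. f n s) sums (LBINT s:S. F s)"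
proof -
  have f_int: "set_integrable lborel S (f n)" for n
  proof (rule set_integrable_bound[OF g])
    show "set_borel_measurable lborel S (f n)"
      using S f by (simp add: set_borel_measurable_def)
    have "\<bar>f n s\<bar> \<le> \<bar>g s\<bar>" if "s \<in> S" for s
    proof -
      have "0 \<le> (\<Sum>i<n. \<bar>f i s\<bar>)" by (rule sum_nonneg) simp
      then show ?thesis using bound[OF that, of "Suc n"] unfolding sum.lessThan_Suc by linarith
    qed
    then show "AE s in lborel. s \<in> S \<longrightarrow> norm (f n s) \<le> norm (g s)"
      by (intro AE_I2) auto
  qed
  have "(\<lambda>n. LBINT s. indicator S s *\<^sub>R (\<Sum>i<n. f i s)) \<longlonglongrightarrow> (LBINT s. indicator S s *\<^sub>R F s)"
  proof (rule integral_dominated_convergence)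
    show "integrable lborel (\<lambda>s. indicator S s *\<^sub>R g s)"
      using g by (simp add: set_integrable_def)
    show "AE s in lborel. (\<lambda>n. indicator S s *\<^sub>R (\<Sum>i<n. f i s)) \<longlonglongrightarrow> indicator S s *\<^sub>R F s"
      using sums by (intro AE_I2) (auto simp: sums_def indicator_def)
    have "\<bar>\<Sum>i<n. f i s\<bar> \<le> g s" if "s \<in> S" for s n
      using bound[OF that, of n] sum_abs[of "\<lambda>i. f i s" "{..<n}"] by linarith
    then show "AE s in lborel. norm (indicator S s *\<^sub>R (\<Sum>i<n. f i s)) \<le> indicator S s *\<^sub>R g s" for n
      by (intro AE_I2) (auto simp: indicator_def)
  qed (use S f F in auto)
  also have "(\<lambda>n. LBINT s. indicator S s *\<^sub>R (\<Sum>i<n. f i s)) = (\<lambda>n. \<Sum>i<n. LBINT s:S. f i s)"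
  proof
    fix n
    have "(LBINT s. indicator S s *\<^sub>R (\<Sum>i<n. f i s)) = (LBINT s. \<Sum>i<n. indicator S s *\<^sub>R f i s)"
      by (simp add: sum_distrib_left)
    also have "\<dots> = (\<Sum>i<n. LBINT s:S. f i s)"
      unfolding set_lebesgue_integral_def
      by (rule Bochner_Integration.integral_sum) (use f_int in \<open>simp add: set_integrable_def\<close>)
    finally show "(LBINT s. indicator S s *\<^sub>R (\<Sum>i<n. f i s)) = (\<Sum>i<n. LBINT s:S. f i s)" .
  qed
  finally show ?thesis by (simp add: sums_def set_lebesgue_integral_def)
qed

lemma continuous_imp_set_integrable_Icc:
  fixes f :: "real \<Rightarrow> real"
  assumes "continuous_on {a..b} f"
  shows "set_integrable lborel {a..b} f"
  using borel_integrable_compact[OF _ assms]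
  by (simp add: set_integrable_def indicator_scaleR_eq_if)

lemma LBINT_Icc_FTC:
  fixes F f :: "real \<Rightarrow> real"
  assumes "a \<le> b" "\<And>r. (F has_real_derivative f r) (at r)" and "continuous_on {a..b} f"
  shows "(LBINT r:{a..b}. f r) = F b - F a"
proof -
  have "(LBINT r:{a..b}. f r) = integral {a..b} f"
    by (rule set_borel_integral_eq_integral[OF continuous_imp_set_integrable_Icc[OF assms(3)]])
  moreover have "(f has_integral (F b - F a)) {a..b}"
    by (rule fundamental_theorem_of_calculus)
      (auto intro: has_field_derivative_at_within assms
        simp flip: has_real_derivative_iff_has_vector_derivative)
  ultimately show ?thesis
    by (simp add: integral_unique)
qed

text \<open>Integration by parts moves one power from \<open>t - s\<close> to \<open>s\<close>; one of the two
  factors vanishes at either end point, so there are no boundary terms.\<close>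

lemma integral_power_mult_power:
  fixes t :: real
  assumes "t \<ge> 0"
  shows "(LBINT s:{0..t}. (t - s) ^ i / fact i * (s ^ j / fact j)) = t ^ (i + j + 1) / fact (i + j + 1)"
proof -
  have antideriv: "((\<lambda>r. r ^ Suc n / fact (Suc n)) has_real_derivative s ^ n / fact n) (at s)" for n and s :: real
  proof -
    have "((\<lambda>r. r ^ Suc n / fact (Suc n)) has_real_derivative real (Suc n) * s ^ (Suc n - Suc 0) / fact (Suc n)) (at s)"
      by (intro DERIV_cdivide DERIV_pow)
    also have "real (Suc n) * s ^ (Suc n - Suc 0) / fact (Suc n) = s ^ n / fact n"
      unfolding fact_Suc diff_Suc_Suc minus_nat.diff_0 by (rule mult_divide_mult_cancel_left) simp
    finally show ?thesis .
  qed
  show ?thesis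
  proof (induction i arbitrary: j)
    case 0
    have "(LBINT s:{0..t}. s ^ j / fact j) = t ^ Suc j / fact (Suc j) - 0 ^ Suc j / fact (Suc j)"
      using antideriv by (intro LBINT_Icc_FTC[OF assms]) (auto intro!: continuous_intros)
    then show ?case by simp
  next
    case (Suc i)
    let ?F = "\<lambda>s. (t - s) ^ Suc i / fact (Suc i) * (s ^ Suc j / fact (Suc j))"
    let ?f = "\<lambda>s. (t - s) ^ Suc i / fact (Suc i) * (s ^ j / fact j)"
    let ?g = "\<lambda>s. (t - s) ^ i / fact i * (s ^ Suc j / fact (Suc j))"
    have pw': "((\<lambda>r. (t - r) ^ Suc n / fact (Suc n)) has_real_derivative - ((t - s) ^ n / fact n)) (at s)" for n and s :: real
    proof -
      have "((\<lambda>r. t - r) has_real_derivative - 1) (at s)"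
        by (auto intro!: derivative_eq_intros)
      from DERIV_chain2[where f = "\<lambda>r. r ^ Suc n / fact (Suc n)" and g = "\<lambda>r. t - r", OF antideriv this]
      show ?thesis by simp
    qed
    have "(LBINT s:{0..t}. ?f s - ?g s) = ?F t - ?F 0"
    proof (rule LBINT_Icc_FTC[OF assms])
      show "(?F has_real_derivative ?f s - ?g s) (at s)" for s
        using DERIV_mult[OF pw'[of i s] antideriv[of j s]] by (simp add: algebra_simps del: power_Suc fact_Suc)
    qed (auto intro!: continuous_intros)
    moreover have "(LBINT s:{0..t}. ?f s - ?g s) = (LBINT s:{0..t}. ?f s) - (LBINT s:{0..t}. ?g s)"
      by (intro set_integral_diff continuous_imp_set_integrable_Icc continuous_intros) auto
    moreover have "?F t - ?F 0 = 0" by simp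
    ultimately have "(LBINT s:{0..t}. ?f s) = (LBINT s:{0..t}. ?g s)" by linarith
    then show ?case using Suc[of "Suc j"] by simp
  qed
qed

section \<open>Exponential generating functions and convolution\<close>

text \<open>The exponent \<open>Suc n\<close> instead of \<open>n\<close> lets a single constant serve both as prefactor and as growth rate.\<close>

definition geom_bound :: "real \<Rightarrow> real fps \<Rightarrow> bool" where
  "geom_bound C f \<longleftrightarrow> (\<forall>n. \<bar>f $ n\<bar> \<le> C ^ Suc n)"

lemma geom_bound_nonneg: "geom_bound C f \<Longrightarrow> 0 \<le> C"
  unfolding geom_bound_def by (metis abs_ge_zero order_trans power_one_right One_nat_def)

lemma geom_bound_mono: "geom_bound C f \<Longrightarrow> C \<le> C' \<Longrightarrow> geom_bound C' f"
  using geom_bound_nonneg[of C f] unfolding geom_bound_def by (meson order_trans power_mono)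

lemma geom_bound_mult:
  assumes f: "geom_bound C f" and g: "geom_bound C g" and C: "1 \<le> C"
  shows "geom_bound (2 * C\<^sup>2) (f * g)"
  unfolding geom_bound_def
proof
  fix n
  have "\<bar>(f * g) $ n\<bar> \<le> (\<Sum>i\<le>n. \<bar>f $ i\<bar> * \<bar>g $ (n - i)\<bar>)"
    unfolding fps_mult_nth atLeast0AtMost by (rule order_trans[OF sum_abs]) (simp add: abs_mult)
  also have "\<dots> \<le> (\<Sum>i\<le>n. C ^ Suc i * C ^ Suc (n - i))"
    using f g C by (intro sum_mono mult_mono) (auto simp: geom_bound_def)
  also have "\<dots> = (\<Sum>i\<le>n. C ^ (n + 2))"
    
  proof (rule sum.cong[OF refl])
    fix i assume "i \<in> {..n}"
    then have "Suc i + Suc (n - i) = n + 2" by simp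
    then show "C ^ Suc i * C ^ Suc (n - i) = C ^ (n + 2)" by (metis power_add)
  qed
  also have "\<dots> = real (Suc n) * C ^ (n + 2)" by (simp add: power2_eq_square)
  also have "\<dots> \<le> 2 ^ Suc n * C ^ (2 * Suc n)"
  proof (intro mult_mono power_increasing)
    show "real (Suc n) \<le> 2 ^ Suc n"
      using less_exp[of "Suc n"] by (metis less_imp_le of_nat_le_iff of_nat_numeral of_nat_power)
  qed (use C in auto)
  also have "\<dots> = (2 * C\<^sup>2) ^ Suc n" by (simp only: power_mult_distrib power_mult)
  finally show "\<bar>(f * g) $ n\<bar> \<le> (2 * C\<^sup>2) ^ Suc n" .
qed

lemma geom_bound_1I: "(\<And>n. \<bar>f $ n\<bar> \<le> 1) \<Longrightarrow> 1 \<le> C \<Longrightarrow> geom_bound C f"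
  unfolding geom_bound_def using one_le_power order_trans by blast

definition egf :: "real fps \<Rightarrow> real \<Rightarrow> real" where
  "egf f t = (\<Sum>n. f $ n * t ^ n / fact n)"

lemma sums_exp_majorant: "(\<lambda>n. C ^ Suc n * x ^ n / fact n) sums (C * exp (C * x))" for C x :: real
  using sums_mult[OF exp_converges[of "C * x"], of C]
  by (simp add: power_mult_distrib field_simps)

lemma egf_term_bound:
  assumes "geom_bound C f" "\<bar>t\<bar> \<le> T"
  shows "\<bar>f $ n * t ^ n / fact n\<bar> \<le> C ^ Suc n * T ^ n / fact n"
proof -
  have "\<bar>f $ n\<bar> * \<bar>t\<bar> ^ n \<le> C ^ Suc n * T ^ n"
    using assms geom_bound_nonneg[OF assms(1)]
    by (intro mult_mono power_mono) (auto simp: geom_bound_def)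
  then show ?thesis by (simp add: abs_mult power_abs divide_right_mono)
qed

lemma egf_summable_abs:
  assumes "geom_bound C f"
  shows "summable (\<lambda>n. \<bar>f $ n * t ^ n / fact n\<bar>)"
  using egf_term_bound[OF assms order_refl]
  by (intro summable_comparison_test[OF _ sums_summable[OF sums_exp_majorant[of C "\<bar>t\<bar>"]]] exI[of _ 0]) simp

lemma egf_suminf_abs_le:
  assumes "geom_bound C f" "\<bar>t\<bar> \<le> T"
  shows "(\<Sum>n. \<bar>f $ n * t ^ n / fact n\<bar>) \<le> C * exp (C * T)"
  using suminf_le[OF egf_term_bound[OF assms] egf_summable_abs[OF assms(1)] sums_summable[OF sums_exp_majorant[of C T]]]
  by (simp only: sums_unique[OF sums_exp_majorant[of C T]])

lemma egf_sums:
  assumes "geom_bound C f"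
  shows "(\<lambda>n. f $ n * t ^ n / fact n) sums egf f t"
  unfolding egf_def by (rule summable_sums[OF summable_rabs_cancel[OF egf_summable_abs[OF assms]]])

lemma egf_eqI: "(\<lambda>n. f $ n * t ^ n / fact n) sums x \<Longrightarrow> egf f t = x"
  by (simp add: egf_def sums_iff)

lemma abs_egf_le:
  assumes "geom_bound C f" "\<bar>t\<bar> \<le> T"
  shows "\<bar>egf f t\<bar> \<le> C * exp (C * T)"
  using summable_rabs[OF egf_summable_abs[OF assms(1), of t]] egf_suminf_abs_le[OF assms]
  by (simp add: egf_def)

lemma borel_measurable_egf [measurable]: "egf f \<in> borel_measurable borel"
  unfolding egf_def[abs_def] by measurable

text \<open>The Cauchy product is formed under the integral sign; the exponential majorants of both factors
  dominate its partial sums on \<open>{0..t}\<close>, and each term is an integral of two monomials.\<close>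

lemma egf_convolution_sums:
  assumes f: "geom_bound C f" and h: "geom_bound C' h" and t: "0 \<le> t"
  shows "(\<lambda>n. (fps_X * (f * h)) $ n * t ^ n / fact n) sums (LBINT s:{0..t}. egf f (t - s) * egf h s)"
proof -
  define a where "a s i = f $ i * (t - s) ^ i / fact i" for s i
  define b where "b s i = h $ i * s ^ i / fact i" for s i
  have nn: "0 \<le> C" "0 \<le> C'" using f h by (auto dest: geom_bound_nonneg)
  have sa: "summable (\<lambda>i. \<bar>a s i\<bar>)" and sb: "summable (\<lambda>i. \<bar>b s i\<bar>)" for s
    unfolding a_def b_def using egf_summable_abs f h by blast+
  have "(\<lambda>n. LBINT s:{0..t}. (\<Sum>i\<le>n. a s i * b s (n - i))) sums (LBINT s:{0..t}. egf f (t - s) * egf h s)"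
  proof (rule set_integral_sums_dominated)
    show "set_integrable lborel {0..t} (\<lambda>s. C * exp (C * t) * (C' * exp (C' * t)))"
      unfolding set_integrable_def by (intro borel_integrable_compact) auto
    fix s assume s: "s \<in> {0..t}"
    show "(\<lambda>n. \<Sum>i\<le>n. a s i * b s (n - i)) sums (egf f (t - s) * egf h s)"
      using Cauchy_product_sums[of "a s" "b s"] sa sb by (simp add: egf_def a_def b_def)
    have "(\<lambda>n. \<Sum>i\<le>n. \<bar>a s i\<bar> * \<bar>b s (n - i)\<bar>) sums ((\<Sum>i. \<bar>a s i\<bar>) * (\<Sum>i. \<bar>b s i\<bar>))"
      using Cauchy_product_sums[of "\<lambda>i. \<bar>a s i\<bar>" "\<lambda>i. \<bar>b s i\<bar>"] sa sb by simp
    then have "(\<Sum>n<N. \<Sum>i\<le>n. \<bar>a s i\<bar> * \<bar>b s (n - i)\<bar>) \<le> (\<Sum>i. \<bar>a s i\<bar>) * (\<Sum>i. \<bar>b s i\<bar>)" for N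
      unfolding sums_iff by (metis (no_types, lifting) abs_ge_zero finite_lessThan mult_nonneg_nonneg sum_le_suminf sum_nonneg)
    moreover have "(\<Sum>i. \<bar>a s i\<bar>) * (\<Sum>i. \<bar>b s i\<bar>) \<le> C * exp (C * t) * (C' * exp (C' * t))"
      unfolding a_def b_def using s f h nn egf_summable_abs[OF h]
      by (intro mult_mono egf_suminf_abs_le suminf_nonneg) auto
    moreover have "(\<Sum>n<N. \<bar>\<Sum>i\<le>n. a s i * b s (n - i)\<bar>) \<le> (\<Sum>n<N. \<Sum>i\<le>n. \<bar>a s i\<bar> * \<bar>b s (n - i)\<bar>)" for N
      by (intro sum_mono order_trans[OF sum_abs]) (simp add: abs_mult)
    ultimately show "(\<Sum>n<N. \<bar>\<Sum>i\<le>n. a s i * b s (n - i)\<bar>) \<le> C * exp (C * t) * (C' * exp (C' * t))" for N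
      by (meson order_trans)
  qed (auto simp: a_def b_def)
  also have "(\<lambda>n. LBINT s:{0..t}. (\<Sum>i\<le>n. a s i * b s (n - i))) = (\<lambda>n. (fps_X * (f * h)) $ Suc n * t ^ Suc n / fact (Suc n))"
  proof
    fix n
    have "(LBINT s:{0..t}. (\<Sum>i\<le>n. a s i * b s (n - i))) = (\<Sum>i\<le>n. LBINT s:{0..t}. a s i * b s (n - i))"
      
      unfolding a_def b_def set_lebesgue_integral_def scaleR_sum_right
      by (rule Bochner_Integration.integral_sum, fold set_integrable_def) (auto intro!: continuous_imp_set_integrable_Icc continuous_intros)
    also have "\<dots> = (\<Sum>i\<le>n. f $ i * h $ (n - i) * (LBINT s:{0..t}. (t - s) ^ i / fact i * (s ^ (n - i) / fact (n - i))))"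
      by (subst set_integral_mult_right[symmetric]) (simp add: a_def b_def mult_ac)
    also have "\<dots> = (\<Sum>i\<le>n. f $ i * h $ (n - i) * (t ^ Suc n / fact (Suc n)))"
    proof (rule sum.cong[OF refl])
      fix i assume "i \<in> {..n}"
      then have "i + (n - i) + 1 = Suc n" by simp
      then show "f $ i * h $ (n - i) * (LBINT s:{0..t}. (t - s) ^ i / fact i * (s ^ (n - i) / fact (n - i)))
          = f $ i * h $ (n - i) * (t ^ Suc n / fact (Suc n))"
        by (simp only: integral_power_mult_power[OF t])
    qed
    finally show "(LBINT s:{0..t}. (\<Sum>i\<le>n. a s i * b s (n - i))) = (fps_X * (f * h)) $ Suc n * t ^ Suc n / fact (Suc n)"
      by (simp add: fps_mult_nth[of f h] atLeast0AtMost sum_distrib_right sum_divide_distrib del: fact_Suc power_Suc)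
  qed
  finally show ?thesis by (subst (asm) sums_Suc_iff) (simp add: fps_mult_nth[of fps_X])
qed

lemma egf_mult_arg:
  assumes "geom_bound C f"
  shows "(\<lambda>n. (fps_X * fps_deriv (fps_X * f)) $ n * t ^ n / fact n) sums (t * egf f t)"
proof -
  have "(\<lambda>n. t * (f $ n * t ^ n / fact n)) sums (t * egf f t)"
    by (intro sums_mult egf_sums[OF assms])
  also have "(\<lambda>n. t * (f $ n * t ^ n / fact n)) = (\<lambda>n. (fps_X * fps_deriv (fps_X * f)) $ Suc n * t ^ Suc n / fact (Suc n))"
  proof
    fix n
    have "(fps_X * fps_deriv (fps_X * f)) $ Suc n = real (Suc n) * f $ n"
      by (simp add: algebra_simps)
    then show "t * (f $ n * t ^ n / fact n) = (fps_X * fps_deriv (fps_X * f)) $ Suc n * t ^ Suc n / fact (Suc n)"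
      unfolding fact_Suc by (simp add: mult_ac del: of_nat_Suc)
  qed
  finally show ?thesis by (subst (asm) sums_Suc_iff) simp
qed

section \<open>The resolvent series and its parameters\<close>

text \<open>The series of \<open>e\<^sup>t (a k + c j)\<close>, multiplied by \<open>X\<close>.\<close>

definition kernel_fps :: "real \<Rightarrow> real \<Rightarrow> real fps" where
  "kernel_fps a c = fps_const a * Kfps + fps_const c * Jfps"

text \<open>This is \<open>e\<^sup>-\<^sup>a (1 - X)\<^sup>c\<^sup>+\<^sup>a\<^sup>-\<^sup>a\<^sup>/\<^sup>X\<close>; multiplication by it represents the operator
  \<open>f \<mapsto> f - f * m\<^bsub>a,c\<^esub>\<close>.\<close>

definition resolvent_fps :: "real \<Rightarrow> real \<Rightarrow> real fps" where
  "resolvent_fps a c = fexp (- kernel_fps a c)"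

lemma kernel_fps_nth_0 [simp]: "kernel_fps a c $ 0 = 0" by (simp add: kernel_fps_def)
lemma resolvent_fps_nth_0 [simp]: "resolvent_fps a c $ 0 = 1" by (simp add: resolvent_fps_def)

lemma fps_deriv_resolvent_fps: "fps_deriv (resolvent_fps a c) = - (fps_deriv (kernel_fps a c) * resolvent_fps a c)"
  by (simp add: resolvent_fps_def fps_deriv_fexp)

lemma resolvent_fps_split: "resolvent_fps a c = fexp (fps_const (- a) * Kfps) * fexp (fps_const (- c) * Jfps)"
  unfolding resolvent_fps_def kernel_fps_def
  by (subst fexp_add[symmetric]) (simp_all flip: fps_const_neg)

lemma fps_deriv_Jfps_nth: "fps_deriv Jfps $ n = 1"
  by (simp del: of_nat_Suc)

lemma fps_deriv_Kfps_nth: "fps_deriv Kfps $ n = 1 / real (n + 2)"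
  by (simp del: of_nat_Suc)

lemma fps_deriv_kernel_fps_bound: "\<bar>fps_deriv (kernel_fps a c) $ n\<bar> \<le> \<bar>a\<bar> + \<bar>c\<bar>"
proof -
  have "fps_deriv (kernel_fps a c) $ n = a * (1 / real (n + 2)) + c"
    unfolding kernel_fps_def
    by (simp add: fps_deriv_Jfps_nth fps_deriv_Kfps_nth del: fps_deriv_nth)
  moreover have "\<bar>a * (1 / real (n + 2))\<bar> \<le> \<bar>a\<bar> * 1"
    unfolding abs_mult by (rule mult_left_mono) auto
  ultimately show ?thesis using abs_triangle_ineq[of "a * (1 / real (n + 2))" c] by linarith
qed

text \<open>The differential equation expresses \<open>n\<close> times the \<open>n\<close>-th coefficient by the earlier ones with weights at
  most \<open>A\<close>, and \<open>(1 + A)\<^sup>n\<close> solves the resulting extremal recursion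
  \<open>b\<^sub>n = 1 + A (b\<^sub>0 + \<dots> + b\<^sub>n\<^sub>-\<^sub>1)\<close>.\<close>

lemma resolvent_fps_bound:
  assumes "\<bar>a\<bar> + \<bar>c\<bar> \<le> A"
  shows "\<bar>resolvent_fps a c $ n\<bar> \<le> (1 + A) ^ n"
proof (induction n rule: less_induct)
  case (less n)
  have A: "0 \<le> A" using assms by linarith
  show ?case
  proof (cases n)
    case (Suc m)
    have "real n * \<bar>resolvent_fps a c $ n\<bar> = \<bar>fps_deriv (resolvent_fps a c) $ m\<bar>"
      by (simp add: Suc abs_mult)
    also have "\<dots> = \<bar>\<Sum>i\<le>m. fps_deriv (kernel_fps a c) $ (m - i) * resolvent_fps a c $ i\<bar>"
      unfolding fps_deriv_resolvent_fps mult.commute[of "fps_deriv (kernel_fps a c)"]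
      by (simp add: fps_mult_nth atLeast0AtMost mult.commute)
    also have "\<dots> \<le> (\<Sum>i\<le>m. A * (1 + A) ^ i)"
    proof (rule order_trans[OF sum_abs sum_mono])
      fix i assume "i \<in> {..m}"
      then show "\<bar>fps_deriv (kernel_fps a c) $ (m - i) * resolvent_fps a c $ i\<bar> \<le> A * (1 + A) ^ i"
        unfolding abs_mult using less.IH[of i] Suc A assms order_trans[OF fps_deriv_kernel_fps_bound assms]
        by (intro mult_mono) (auto simp del: fps_deriv_nth)
    qed
    also have "\<dots> = (1 + A) ^ n - 1"
    proof -
      have "(\<Sum>i\<le>k. A * (1 + A) ^ i) = (1 + A) ^ Suc k - 1" for k
        by (induction k) (auto simp: algebra_simps)
      then show ?thesis using Suc by simp
    qed
    finally have *: "real n * \<bar>resolvent_fps a c $ n\<bar> \<le> (1 + A) ^ n" by simp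
    have "1 * \<bar>resolvent_fps a c $ n\<bar> \<le> real n * \<bar>resolvent_fps a c $ n\<bar>"
      using Suc by (intro mult_right_mono) auto
    then show ?thesis using * by simp
  qed simp
qed

lemma geom_bound_resolvent_fps:
  assumes "\<bar>a\<bar> + \<bar>c\<bar> \<le> A"
  shows "geom_bound (1 + A) (resolvent_fps a c)"
  unfolding geom_bound_def
proof
  fix n
  have "(1 + A) ^ n \<le> (1 + A) ^ Suc n" using assms by (intro power_increasing) auto
  then show "\<bar>resolvent_fps a c $ n\<bar> \<le> (1 + A) ^ Suc n" using resolvent_fps_bound[OF assms, of n] by linarith
qed

definition k_fps :: "real fps" where "k_fps = fps_shift 1 Kfps"
definition j_fps :: "real fps" where "j_fps = fps_shift 1 Jfps"
definition density_fps :: "real \<Rightarrow> real \<Rightarrow> real fps" where "density_fps a c = fps_shift 1 (1 - resolvent_fps a c)"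

lemma fps_X_mult_shift: "F $ 0 = 0 \<Longrightarrow> fps_X * fps_shift 1 F = (F :: real fps)"
  by (rule fps_ext) auto

lemma X_k_fps: "fps_X * k_fps = Kfps" and X_j_fps: "fps_X * j_fps = Jfps"
  unfolding k_fps_def j_fps_def by (rule fps_X_mult_shift; simp)+

lemma X_density_fps: "fps_X * density_fps a c = 1 - resolvent_fps a c"
  unfolding density_fps_def by (rule fps_X_mult_shift) simp

lemma resolvent_fps_eq: "resolvent_fps a c = 1 - fps_X * density_fps a c"
  by (simp add: X_density_fps)

lemma geom_bound_density_fps:
  assumes "\<bar>a\<bar> + \<bar>c\<bar> \<le> A"
  shows "geom_bound (1 + A) (density_fps a c)"
  using resolvent_fps_bound[OF assms] by (auto simp: geom_bound_def density_fps_def simp del: power_Suc)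

lemma geom_bound_k_fps: "1 \<le> C \<Longrightarrow> geom_bound C k_fps"
  by (rule geom_bound_1I) (auto simp: k_fps_def divide_simps intro: mult_ge1_I)

lemma geom_bound_j_fps: "1 \<le> C \<Longrightarrow> geom_bound C j_fps"
  by (rule geom_bound_1I) (auto simp: j_fps_def)

lemma egf_0: "egf f 0 = f $ 0"
  using powser_zero[of "\<lambda>n. f $ n / fact n"] by (simp add: egf_def)

lemma kfun_egf:
  assumes "t \<ge> 0"
  shows "kfun t = exp (- t) * egf k_fps t"
proof (cases "t = 0")
  case True
  have "egf k_fps 0 = 1 / 2" by (simp add: egf_0 k_fps_def)
  then show ?thesis using True by (simp add: kfun_0)
next
  case False
  have "(\<lambda>n. t ^ (n + 2) / fact (n + 2)) sums (exp t - (\<Sum>i<2. t ^ i / fact i))"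
    using sums_split_initial_segment[OF exp_converges[of t], of 2] by (simp add: field_simps)
  from sums_divide[OF this, of "t\<^sup>2"]
  have "(\<lambda>n. t ^ (n + 2) / fact (n + 2) / t\<^sup>2) sums ((exp t - 1 - t) / t\<^sup>2)"
    by (simp add: eval_nat_numeral algebra_simps)
  also have "(\<lambda>n. t ^ (n + 2) / fact (n + 2) / t\<^sup>2) = (\<lambda>n. k_fps $ n * t ^ n / fact n)"
  proof
    fix n
    have "fact (n + 2) = (real n + 2) * ((real n + 1) * fact n)" by (simp add: algebra_simps)
    then show "t ^ (n + 2) / fact (n + 2) / t\<^sup>2 = k_fps $ n * t ^ n / fact n"
      using False 
      by (simp add: k_fps_def power_add power2_eq_square divide_simps del: fact_Suc) (simp add: algebra_simps)
  qed
  finally have "egf k_fps t = (exp t - 1 - t) / t\<^sup>2" by (rule egf_eqI)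
  moreover have "exp (- t) * (exp t - 1 - t) = 1 - (1 + t) * exp (- t)"
    by (simp add: algebra_simps flip: exp_add)
  ultimately show ?thesis using False assms
    by (simp add: kfun_closed_form)
qed

lemma jfun_egf:
  assumes "t \<ge> 0"
  shows "jfun t = exp (- t) * egf j_fps t"
proof (cases "t = 0")
  case True
  have "egf j_fps 0 = 1" by (simp add: egf_0 j_fps_def)
  then show ?thesis using True by (simp add: jfun_0)
next
  case False
  have "(\<lambda>n. t ^ (n + 1) / fact (n + 1)) sums (exp t - (\<Sum>i<1. t ^ i / fact i))"
    using sums_split_initial_segment[OF exp_converges[of t], of 1] by (simp add: field_simps)
  from sums_divide[OF this, of t]
  have "(\<lambda>n. t ^ (n + 1) / fact (n + 1) / t) sums ((exp t - 1) / t)"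
    by simp
  also have "(\<lambda>n. t ^ (n + 1) / fact (n + 1) / t) = (\<lambda>n. j_fps $ n * t ^ n / fact n)"
    using False by (simp add: j_fps_def power_add divide_simps)
  finally have "egf j_fps t = (exp t - 1) / t" by (rule egf_eqI)
  moreover have "exp (- t) * (exp t - 1) = 1 - exp (- t)"
    by (simp add: algebra_simps flip: exp_add)
  ultimately show ?thesis using False assms
    by (simp add: jfun_closed_form)
qed

lemma conv_exp_egf:
  assumes f: "geom_bound C F" "\<And>s. 0 \<le> s \<Longrightarrow> f s = exp (- s) * egf F s"
    and h: "geom_bound C' H" "\<And>s. 0 \<le> s \<Longrightarrow> h s = exp (- s) * egf H s"
    and t: "0 \<le> t"
  shows "(\<lambda>n. (fps_X * (F * H)) $ n * t ^ n / fact n) sums (exp t * conv f h t)"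
proof -
  have "conv f h t = (LBINT s:{0..t}. exp (- t) * (egf F (t - s) * egf H s))"
    unfolding conv_def
  proof (rule set_lebesgue_integral_cong)
    show "\<forall>s. s \<in> {0..t} \<longrightarrow> f (t - s) * h s = exp (- t) * (egf F (t - s) * egf H s)"
    proof (intro allI impI)
      fix s assume "s \<in> {0..t}"
      then have "f (t - s) * h s = exp (- (t - s)) * egf F (t - s) * (exp (- s) * egf H s)"
        by (simp add: f(2) h(2))
      also have "\<dots> = (exp (- (t - s)) * exp (- s)) * (egf F (t - s) * egf H s)"
        by (simp only: mult_ac)
      also have "exp (- (t - s)) * exp (- s) = exp (- t)" by (simp flip: exp_add)
      finally show "f (t - s) * h s = exp (- t) * (egf F (t - s) * egf H s)" .
    qed
  qed simp
  then have "exp t * conv f h t = (LBINT s:{0..t}. egf F (t - s) * egf H s)"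
    by (simp add: exp_minus)
  then show ?thesis using egf_convolution_sums[OF f(1) h(1) t] by simp
qed

definition density_series :: "real \<Rightarrow> real \<Rightarrow> real \<Rightarrow> real" where
  "density_series a c t = exp (- t) * egf (density_fps a c) t"

lemma geom_bound_density_fps': "geom_bound (1 + (\<bar>a\<bar> + \<bar>c\<bar>)) (density_fps a c)"
  by (rule geom_bound_density_fps) simp

text \<open>Convolution with \<open>m\<close> is multiplication by \<open>X d = 1 - G\<close>, so subtracting it from the identity leaves
  multiplication by \<open>G\<close>.\<close>

lemma kernel_conv_density_series:
  assumes F: "geom_bound C F" and f: "\<And>s. 0 \<le> s \<Longrightarrow> f s = exp (- s) * egf F s" and t: "0 \<le> t"
  shows "f t - conv f (density_series a c) t = exp (- t) * egf (F * resolvent_fps a c) t"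
proof -
  have "(\<lambda>n. F $ n * t ^ n / fact n - (fps_X * (F * density_fps a c)) $ n * t ^ n / fact n)
      sums (egf F t - exp t * conv f (density_series a c) t)"
    by (intro sums_diff egf_sums[OF F] conv_exp_egf[OF F f geom_bound_density_fps' _ t] density_series_def)
  moreover have "F $ n * t ^ n / fact n - (fps_X * (F * density_fps a c)) $ n * t ^ n / fact n
      = (F * resolvent_fps a c) $ n * t ^ n / fact n" for n
    unfolding resolvent_fps_eq by (simp add: algebra_simps diff_divide_distrib)
  ultimately have "egf (F * resolvent_fps a c) t = egf F t - exp t * conv f (density_series a c) t"
    by (intro egf_eqI) simp
  then show ?thesis using f[OF t] by (simp add: right_diff_distrib flip: exp_add)
qed

lemma Qfun_egf:
  assumes "t \<ge> 0"
  shows "Qfun a c t = exp (- t) * egf (fps_X * fps_deriv (kernel_fps a c)) t"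
proof -
  have kernel_fps: "kernel_fps a c = fps_X * (fps_const a * k_fps + fps_const c * j_fps)"
    by (simp add: kernel_fps_def algebra_simps flip: X_k_fps X_j_fps)
  have k: "(\<lambda>n. (fps_X * fps_deriv (fps_X * k_fps)) $ n * t ^ n / fact n) sums (t * egf k_fps t)"
    and j: "(\<lambda>n. (fps_X * fps_deriv (fps_X * j_fps)) $ n * t ^ n / fact n) sums (t * egf j_fps t)"
    by (rule egf_mult_arg[OF geom_bound_k_fps[OF order_refl]] egf_mult_arg[OF geom_bound_j_fps[OF order_refl]])+
  have "(\<lambda>n. (fps_X * fps_deriv (kernel_fps a c)) $ n * t ^ n / fact n) sums (a * (t * egf k_fps t) + c * (t * egf j_fps t))"
    using sums_add[OF sums_mult[OF k, of a] sums_mult[OF j, of c]]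
    unfolding kernel_fps by (elim back_subst[of "\<lambda>f. f sums _"]) (auto simp: algebra_simps add_divide_distrib)
  from egf_eqI[OF this] show ?thesis
    by (simp add: Qfun_def kfun_egf jfun_egf assms algebra_simps)
qed

text \<open>The equation \<open>X (X d)' = - X G' = X (a K + c J)' G\<close>, read through the dictionary between functions and
  series.\<close>

lemma density_series_volterra:
  assumes t: "t \<ge> 0"
  shows "t * density_series a c t = Qfun a c t - conv (Qfun a c) (density_series a c) t"
proof -
  have Qb: "geom_bound (1 + (\<bar>a\<bar> + \<bar>c\<bar>)) (fps_X * fps_deriv (kernel_fps a c))"
    unfolding geom_bound_def
  proof
    fix n
    have "\<bar>(fps_X * fps_deriv (kernel_fps a c)) $ n\<bar> \<le> \<bar>a\<bar> + \<bar>c\<bar>"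
      using fps_deriv_kernel_fps_bound[of a c "n - 1"] by (cases n) (auto simp del: fps_deriv_nth)
    also have "\<dots> \<le> (1 + (\<bar>a\<bar> + \<bar>c\<bar>)) ^ 1" by simp
    also have "\<dots> \<le> (1 + (\<bar>a\<bar> + \<bar>c\<bar>)) ^ Suc n" by (rule power_increasing) auto
    finally show "\<bar>(fps_X * fps_deriv (kernel_fps a c)) $ n\<bar> \<le> (1 + (\<bar>a\<bar> + \<bar>c\<bar>)) ^ Suc n" .
  qed
  have "fps_X * fps_deriv (kernel_fps a c) * resolvent_fps a c = fps_X * fps_deriv (fps_X * density_fps a c)"
    unfolding X_density_fps by (simp add: fps_deriv_resolvent_fps mult.assoc)
  moreover have "egf (fps_X * fps_deriv (fps_X * density_fps a c)) t = t * egf (density_fps a c) t"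
    by (rule egf_eqI[OF egf_mult_arg[OF geom_bound_density_fps']])
  moreover have "Qfun a c t - conv (Qfun a c) (density_series a c) t
      = exp (- t) * egf (fps_X * fps_deriv (kernel_fps a c) * resolvent_fps a c) t"
    by (rule kernel_conv_density_series[OF Qb _ t]) (rule Qfun_egf)
  ultimately have "Qfun a c t - conv (Qfun a c) (density_series a c) t = exp (- t) * (t * egf (density_fps a c) t)"
    by (simp only:)
  then show ?thesis by (simp add: density_series_def)
qed

text \<open>\<open>\<partial>\<^sub>a G = - K G\<close> with an arbitrary multiplier \<open>F\<close>.  Keeping \<open>F\<close> general makes the family closed under
  differentiation, so that second derivatives are covered as well.\<close>

lemma has_real_derivative_mult_resolvent_fps_a:
  "((\<lambda>a. (F * resolvent_fps a c) $ n) has_real_derivative (- (F * Kfps) * resolvent_fps a c) $ n) (at a)"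
proof -
  have eq: "fexp (fps_const (- c) * Jfps + fps_const a * - Kfps) = resolvent_fps a c" for a
    unfolding resolvent_fps_def by (rule arg_cong[of _ _ fexp]) (simp add: kernel_fps_def flip: fps_const_neg)
  have "((\<lambda>a. resolvent_fps a c $ n) has_real_derivative (- Kfps * resolvent_fps a c) $ n) (at a)" for n
    unfolding eq[symmetric] by (rule has_real_derivative_fexp_nth) auto
  then have "((\<lambda>a. \<Sum>i=0..n. F $ i * resolvent_fps a c $ (n - i)) has_real_derivative
      (\<Sum>i=0..n. F $ i * (- Kfps * resolvent_fps a c) $ (n - i))) (at a)"
    by (intro DERIV_sum DERIV_cmult)
  then show ?thesis
    unfolding fps_mult_nth[of F, symmetric] by (simp add: mult.assoc)
qed

lemma has_real_derivative_mult_resolvent_fps_c: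
  "((\<lambda>c. (F * resolvent_fps a c) $ n) has_real_derivative (- (F * Jfps) * resolvent_fps a c) $ n) (at c)"
proof -
  have eq: "fexp (fps_const (- a) * Kfps + fps_const c * - Jfps) = resolvent_fps a c" for c
    unfolding resolvent_fps_def by (rule arg_cong[of _ _ fexp]) (simp add: kernel_fps_def flip: fps_const_neg)
  have "((\<lambda>c. resolvent_fps a c $ n) has_real_derivative (- Jfps * resolvent_fps a c) $ n) (at c)" for n
    unfolding eq[symmetric] by (rule has_real_derivative_fexp_nth) auto
  then have "((\<lambda>c. \<Sum>i=0..n. F $ i * resolvent_fps a c $ (n - i)) has_real_derivative
      (\<Sum>i=0..n. F $ i * (- Jfps * resolvent_fps a c) $ (n - i))) (at c)"
    by (intro DERIV_sum DERIV_cmult)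
  then show ?thesis
    unfolding fps_mult_nth[of F, symmetric] by (simp add: mult.assoc)
qed

lemma density_fps_nth: "density_fps a c $ n = - ((1 * resolvent_fps a c) $ Suc n)"
  by (simp add: density_fps_def)

lemma has_real_derivative_density_fps_a:
  "((\<lambda>a. density_fps a c $ n) has_real_derivative (k_fps * resolvent_fps a c) $ n) (at a)"
  unfolding density_fps_nth
  using DERIV_minus[OF has_real_derivative_mult_resolvent_fps_a[of 1 c "Suc n" a]]
  by (simp add: mult.assoc flip: X_k_fps)

lemma has_real_derivative_density_fps_c:
  "((\<lambda>c. density_fps a c $ n) has_real_derivative (j_fps * resolvent_fps a c) $ n) (at c)"
  unfolding density_fps_nth
  using DERIV_minus[OF has_real_derivative_mult_resolvent_fps_c[of 1 a "Suc n" c]]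
  by (simp add: mult.assoc flip: X_j_fps)

text \<open>A geometric bound on the differentiated coefficients that is uniform near \<open>x0\<close> provides the majorant for
  termwise differentiation.\<close>

lemma has_real_derivative_egf_param:
  fixes f f' :: "real \<Rightarrow> real fps"
  assumes d: "\<And>x n. ((\<lambda>x. f x $ n) has_real_derivative f' x $ n) (at x)"
    and b: "geom_bound B (f x0)"
    and b': "\<And>x. \<bar>x - x0\<bar> < 1 \<Longrightarrow> geom_bound C (f' x)"
  shows "((\<lambda>x. egf (f x) t) has_real_derivative egf (f' x0) t) (at x0)"
  unfolding egf_def
proof (rule has_field_derivative_series'(2)[where S = "ball x0 1"])
  show "((\<lambda>x. f x $ n * t ^ n / fact n) has_real_derivative f' x $ n * t ^ n / fact n) (at x within ball x0 1)" for n x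
    using DERIV_cmult_right[OF has_field_derivative_at_within[OF d], of _ "t ^ n / fact n"] by simp
  show "uniformly_convergent_on (ball x0 1) (\<lambda>n x. \<Sum>i<n. f' x $ i * t ^ i / fact i)"
  proof (rule Weierstrass_m_test')
    show "norm (f' x $ n * t ^ n / fact n) \<le> C ^ Suc n * \<bar>t\<bar> ^ n / fact n" if "x \<in> ball x0 1" for n x
      using egf_term_bound[OF b' order_refl] that by (simp add: dist_real_def abs_minus_commute)
    show "summable (\<lambda>n. C ^ Suc n * \<bar>t\<bar> ^ n / fact n)"
      by (rule sums_summable[OF sums_exp_majorant])
  qed
  show "summable (\<lambda>n. f x0 $ n * t ^ n / fact n)"
    by (rule sums_summable[OF egf_sums[OF b]])
qed auto

text \<open>For \<open>F\<close> the series of \<open>e\<^sup>t f\<close> this is the function \<open>f - f * m\<^bsub>a,c\<^esub>\<close>; the partial derivatives of all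
  orders of the density have this form.\<close>

definition resolvent_mult :: "real fps \<Rightarrow> real \<Rightarrow> real \<Rightarrow> real \<Rightarrow> real" where
  "resolvent_mult F a c t = exp (- t) * egf (F * resolvent_fps a c) t"

lemma geom_bound_mult_resolvent_fps:
  assumes F: "geom_bound C F" and C: "1 \<le> C" and ac: "1 + (\<bar>a\<bar> + \<bar>c\<bar>) \<le> C"
  shows "geom_bound (2 * C\<^sup>2) (F * resolvent_fps a c)"
  by (rule geom_bound_mult[OF F geom_bound_mono[OF geom_bound_resolvent_fps[OF order_refl] ac] C])

lemma geom_bound_uminus: "geom_bound C f \<Longrightarrow> geom_bound C (- f)"
  by (simp add: geom_bound_def)

lemma has_real_derivative_resolvent_mult_a:
  assumes F: "geom_bound C F" and FK: "geom_bound C (F * Kfps)"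
  shows "((\<lambda>a. resolvent_mult F a c t) has_real_derivative resolvent_mult (- (F * Kfps)) a c t) (at a)"
proof -
  define A where "A = max C (2 + \<bar>a\<bar> + \<bar>c\<bar>)"
  have "((\<lambda>a. egf (F * resolvent_fps a c) t) has_real_derivative egf (- (F * Kfps) * resolvent_fps a c) t) (at a)"
  proof (rule has_real_derivative_egf_param)
    show "geom_bound (2 * A\<^sup>2) (F * resolvent_fps a c)"
      by (intro geom_bound_mult_resolvent_fps geom_bound_mono[OF F]) (auto simp: A_def)
    show "geom_bound (2 * A\<^sup>2) (- (F * Kfps) * resolvent_fps x c)" if "\<bar>x - a\<bar> < 1" for x
      using that by (intro geom_bound_mult_resolvent_fps geom_bound_uminus geom_bound_mono[OF FK]) (auto simp: A_def)
  qed (rule has_real_derivative_mult_resolvent_fps_a)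
  from DERIV_cmult[OF this, of "exp (- t)"] show ?thesis by (simp only: resolvent_mult_def)
qed

lemma has_real_derivative_resolvent_mult_c:
  assumes F: "geom_bound C F" and FJ: "geom_bound C (F * Jfps)"
  shows "((\<lambda>c. resolvent_mult F a c t) has_real_derivative resolvent_mult (- (F * Jfps)) a c t) (at c)"
proof -
  define A where "A = max C (2 + \<bar>a\<bar> + \<bar>c\<bar>)"
  have "((\<lambda>c. egf (F * resolvent_fps a c) t) has_real_derivative egf (- (F * Jfps) * resolvent_fps a c) t) (at c)"
  proof (rule has_real_derivative_egf_param)
    show "geom_bound (2 * A\<^sup>2) (F * resolvent_fps a c)"
      by (intro geom_bound_mult_resolvent_fps geom_bound_mono[OF F]) (auto simp: A_def)
    show "geom_bound (2 * A\<^sup>2) (- (F * Jfps) * resolvent_fps a x)" if "\<bar>x - c\<bar> < 1" for x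
      using that by (intro geom_bound_mult_resolvent_fps geom_bound_uminus geom_bound_mono[OF FJ]) (auto simp: A_def)
  qed (rule has_real_derivative_mult_resolvent_fps_c)
  from DERIV_cmult[OF this, of "exp (- t)"] show ?thesis by (simp only: resolvent_mult_def)
qed

lemma has_real_derivative_density_series_a:
  "((\<lambda>a. density_series a c t) has_real_derivative resolvent_mult k_fps a c t) (at a)"
proof -
  define A where "A = 2 + \<bar>a\<bar> + \<bar>c\<bar>"
  have "((\<lambda>a. egf (density_fps a c) t) has_real_derivative egf (k_fps * resolvent_fps a c) t) (at a)"
  proof (rule has_real_derivative_egf_param)
    show "geom_bound (2 * A\<^sup>2) (k_fps * resolvent_fps x c)" if "\<bar>x - a\<bar> < 1" for x
      using that by (intro geom_bound_mult_resolvent_fps geom_bound_k_fps) (auto simp: A_def)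
  qed (rule has_real_derivative_density_fps_a geom_bound_density_fps')+
  from DERIV_cmult[OF this, of "exp (- t)"] show ?thesis by (simp only: resolvent_mult_def density_series_def)
qed

lemma has_real_derivative_density_series_c:
  "((\<lambda>c. density_series a c t) has_real_derivative resolvent_mult j_fps a c t) (at c)"
proof -
  define A where "A = 2 + \<bar>a\<bar> + \<bar>c\<bar>"
  have "((\<lambda>c. egf (density_fps a c) t) has_real_derivative egf (j_fps * resolvent_fps a c) t) (at c)"
  proof (rule has_real_derivative_egf_param)
    show "geom_bound (2 * A\<^sup>2) (j_fps * resolvent_fps a x)" if "\<bar>x - c\<bar> < 1" for x
      using that by (intro geom_bound_mult_resolvent_fps geom_bound_j_fps) (auto simp: A_def)
  qed (rule has_real_derivative_density_fps_c geom_bound_density_fps')+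
  from DERIV_cmult[OF this, of "exp (- t)"] show ?thesis by (simp only: resolvent_mult_def density_series_def)
qed

lemma resolvent_mult_k_fps: "t \<ge> 0 \<Longrightarrow> resolvent_mult k_fps a c t = kfun t - conv kfun (density_series a c) t"
  unfolding resolvent_mult_def by (rule kernel_conv_density_series[OF geom_bound_k_fps[OF order_refl] kfun_egf, symmetric])

lemma resolvent_mult_j_fps: "t \<ge> 0 \<Longrightarrow> resolvent_mult j_fps a c t = jfun t - conv jfun (density_series a c) t"
  unfolding resolvent_mult_def by (rule kernel_conv_density_series[OF geom_bound_j_fps[OF order_refl] jfun_egf, symmetric])

section \<open>Moments of the weight function\<close>

definition beta_kernel :: "real \<Rightarrow> real \<Rightarrow> real \<Rightarrow> real" where
  "beta_kernel p q s = s powr p * (1 - s) powr q"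

lemma beta_kernel_nonneg: "0 \<le> beta_kernel p q s"
  by (simp add: beta_kernel_def)

lemma borel_measurable_beta_kernel [measurable]: "beta_kernel p q \<in> borel_measurable borel"
  unfolding beta_kernel_def[abs_def] by measurable

lemma
  assumes "-1 < p" "-1 < q"
  shows set_integrable_beta_kernel: "set_integrable lborel {0<..<1} (beta_kernel p q)"
    and LBINT_beta_kernel: "(LBINT s:{0<..<1}. beta_kernel p q s) = Beta (p + 1) (q + 1)"
proof -
  have "set_integrable lborel {0..1} (beta_kernel p q)"
    using integrable_Beta[of "p + 1" "q + 1"] assms by (simp add: beta_kernel_def[abs_def])
  then show int: "set_integrable lborel {0<..<1} (beta_kernel p q)"
    by (rule set_integrable_subset) auto
  have "(beta_kernel p q has_integral Beta (p + 1) (q + 1)) {0..1}"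
    using has_integral_Beta_real[of "p + 1" "q + 1"] assms by (simp add: beta_kernel_def[abs_def])
  then show "(LBINT s:{0<..<1}. beta_kernel p q s) = Beta (p + 1) (q + 1)"
    using set_borel_integral_eq_integral(2)[OF int]
    by (simp add: has_integral_Icc_iff_Ioo integral_unique)
qed

definition logit :: "real \<Rightarrow> real" where "logit s = ln (s / (1 - s))"

lemma borel_measurable_logit [measurable]: "logit \<in> borel_measurable borel"
  unfolding logit_def[abs_def] by measurable

lemma odds_powr: "0 < s \<Longrightarrow> s < 1 \<Longrightarrow> (s / (1 - s)) powr x = exp (x * logit s)"
  by (simp add: powr_def logit_def)

text \<open>Tilting by a power of the odds \<open>s / (1 - s)\<close> moves exponent from \<open>1 - s\<close> to \<open>s\<close>.  Every integrand
  below is reduced to a Beta integrand in this way.\<close>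

lemma beta_kernel_exp_logit:
  assumes "0 < s" "s < 1"
  shows "exp (x * logit s) * beta_kernel p q s = beta_kernel (p + x) (q - x) s"
  using assms by (simp add: logit_def beta_kernel_def powr_def ln_div algebra_simps flip: exp_add)

lemma beta_kernel_power:
  assumes "0 < s" "s < 1"
  shows "(1 - s) ^ n * s ^ k * beta_kernel p q s = beta_kernel (p + real k) (q + real n) s"
  using assms by (simp add: beta_kernel_def powr_add powr_realpow mult_ac)

text \<open>The Taylor coefficients in \<open>x\<close>, at \<open>0\<close>, of \<open>(s / (1 - s))\<^sup>x sin (\<pi> (c + x))\<close>.  One and the same
  expansion is used with \<open>x = a s\<close>, for the dependence on \<open>a\<close>, and with \<open>x\<close> an increment of \<open>c\<close>.\<close>

definition osc_coeff :: "real \<Rightarrow> nat \<Rightarrow> real \<Rightarrow> real" where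
  "osc_coeff c j s = Im (cis (pi * c) * (of_real (logit s) + \<i> * of_real pi) ^ j) / fact j"

lemma borel_measurable_osc_coeff [measurable]: "osc_coeff c j \<in> borel_measurable borel"
  unfolding osc_coeff_def[abs_def] by measurable

lemma osc_coeff_sums: "(\<lambda>j. osc_coeff c j s * x ^ j) sums (exp (x * logit s) * sin (pi * (c + x)))"
proof -
  define z where "z = of_real (logit s) + \<i> * complex_of_real pi"
  have "(\<lambda>j. cis (pi * c) * ((of_real x * z) ^ j /\<^sub>R fact j)) sums (cis (pi * c) * exp (of_real x * z))"
    by (intro sums_mult exp_converges)
  then have "(\<lambda>j. Im (cis (pi * c) * ((of_real x * z) ^ j /\<^sub>R fact j))) sums Im (cis (pi * c) * exp (of_real x * z))"
    by (rule sums_Im)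
  moreover have "Im (cis (pi * c) * ((of_real x * z) ^ j /\<^sub>R fact j)) = osc_coeff c j s * x ^ j" for j
  proof -
    have "cis (pi * c) * ((of_real x * z) ^ j /\<^sub>R fact j) = of_real (x ^ j / fact j) * (cis (pi * c) * z ^ j)"
      by (simp add: power_mult_distrib scaleR_conv_of_real field_simps)
    moreover have "Im (of_real r * w) = r * Im w" for r and w :: complex by simp
    ultimately show ?thesis
      unfolding osc_coeff_def z_def[symmetric] by (simp only:) (simp only: times_divide_eq_left times_divide_eq_right mult.commute)
  qed
  moreover have "Im (cis (pi * c) * exp (of_real x * z)) = exp (x * logit s) * sin (pi * (c + x))"
  proof -
    have "exp (of_real x * z) = of_real (exp (x * logit s)) * cis (pi * x)"
      unfolding exp_eq_polar by (simp add: z_def mult.commute)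
    then have "cis (pi * c) * exp (of_real x * z) = of_real (exp (x * logit s)) * cis (pi * (c + x))"
      by (simp add: mult.left_commute cis_mult distrib_left)
    then show ?thesis by simp
  qed
  ultimately show ?thesis by simp
qed

lemma osc_coeff_abs_sum_le: "(\<Sum>j<n. \<bar>osc_coeff c j s * x ^ j\<bar>) \<le> exp (\<bar>x\<bar> * (\<bar>logit s\<bar> + pi))"
proof -
  define y where "y = \<bar>x\<bar> * (\<bar>logit s\<bar> + pi)"
  have y: "0 \<le> y" by (simp add: y_def)
  have "\<bar>osc_coeff c j s * x ^ j\<bar> \<le> y ^ j /\<^sub>R fact j" for j
  proof -
    define z where "z = of_real (logit s) + \<i> * complex_of_real pi"
    have "norm z \<le> \<bar>logit s\<bar> + pi"
      unfolding z_def by (rule order_trans[OF norm_triangle_ineq]) (simp add: norm_mult)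
    then have "\<bar>Im (cis (pi * c) * z ^ j)\<bar> \<le> (\<bar>logit s\<bar> + pi) ^ j"
      using abs_Im_le_cmod[of "cis (pi * c) * z ^ j"] power_mono[of "norm z" "\<bar>logit s\<bar> + pi" j]
      by (simp add: norm_mult norm_power)
    then have "\<bar>Im (cis (pi * c) * z ^ j)\<bar> * \<bar>x\<bar> ^ j / fact j \<le> (\<bar>logit s\<bar> + pi) ^ j * \<bar>x\<bar> ^ j / fact j"
      by (intro divide_right_mono mult_right_mono) auto
    also have "\<dots> = y ^ j /\<^sub>R fact j"
      unfolding y_def power_mult_distrib by (simp add: divide_inverse)
    also have "\<bar>Im (cis (pi * c) * z ^ j)\<bar> * \<bar>x\<bar> ^ j / fact j = \<bar>osc_coeff c j s * x ^ j\<bar>"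
      unfolding osc_coeff_def z_def[symmetric] abs_mult abs_divide power_abs by simp
    finally show ?thesis .
  qed
  then have "(\<Sum>j<n. \<bar>osc_coeff c j s * x ^ j\<bar>) \<le> (\<Sum>j<n. y ^ j /\<^sub>R fact j)"
    by (rule sum_mono)
  also have "\<dots> \<le> (\<Sum>j. y ^ j /\<^sub>R fact j)"
    using y by (intro sum_le_suminf sums_summable[OF exp_converges]) auto
  also have "\<dots> = exp y" by (rule sums_unique[OF exp_converges, symmetric])
  finally show ?thesis by (simp only: y_def)
qed

lemma sin_pi_eq_rGamma: "sin (pi * x) = pi * (rGamma x * rGamma (1 - x))" for x :: real
proof -
  have "complex_of_real (rGamma x * rGamma (1 - x)) = complex_of_real (sin (pi * x) / pi)"
    using rGamma_reflection_complex[of "complex_of_real x"] rGamma_complex_of_real[of "1 - x"]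
    by (simp flip: rGamma_complex_of_real sin_of_real)
  then have "rGamma x * rGamma (1 - x) = sin (pi * x) / pi"
    by (simp only: of_real_eq_iff)
  then show ?thesis by simp
qed

lemma rGamma_mult_Gamma_shift:
  fixes x :: real
  assumes "0 < x + real n"
  shows "rGamma x * Gamma (x + real n) = pochhammer x n"
  using Gamma_real_pos[OF assms] unfolding pochhammer_rGamma[of x n]
  by (simp add: rGamma_inverse_Gamma)

text \<open>In \<open>sin (\<pi> x) = \<pi> / (\<Gamma>(x) \<Gamma>(1 - x))\<close> the reciprocal Gamma values cancel against the Gamma values of
  the Beta function up to two rising factorials, which join to the single one in the binomial coefficient
  of \<open>(1 - X)\<^sup>x\<^sup>+\<^sup>k\<close>.  Stated with \<open>rGamma\<close>, which vanishes at
  the poles of the Gamma function, the cancellation covers \<open>x = 0\<close>.\<close>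

lemma sin_mult_Beta:
  fixes x :: real
  assumes "0 < x + real k + 1" "x < real N" "N \<ge> 1"
  shows "sin (pi * x) * Beta (x + real k + 1) (real N - x)
       = pi * (-1) ^ Suc k * fexp (fps_const (- (x + real k)) * Jfps) $ (N + k)"
proof -
  obtain M where N: "N = Suc M" using assms(3) by (cases N) auto
  have G: "Gamma (x + real k + 1 + (real N - x)) = fact (N + k)"
    using Gamma_fact[of "N + k"] by (simp add: algebra_simps)
  have "sin (pi * x) * Beta (x + real k + 1) (real N - x)
      = pi * (rGamma x * Gamma (x + real (Suc k))) * (rGamma (1 - x) * Gamma (1 - x + real M)) / fact (N + k)"
    unfolding Beta_def G sin_pi_eq_rGamma by (simp add: N algebra_simps)
  also have "\<dots> = pi * pochhammer x (Suc k) * pochhammer (1 - x) M / fact (N + k)"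
    using assms rGamma_mult_Gamma_shift[of x "Suc k"] rGamma_mult_Gamma_shift[of "1 - x" M]
    by (simp add: N algebra_simps)
  also have "pochhammer x (Suc k) = (-1) ^ Suc k * pochhammer (- (x + real k)) (Suc k)"
    unfolding pochhammer_minus by (simp flip: power_mult_distrib mult.assoc del: power_Suc)
  also have "pi * ((-1) ^ Suc k * pochhammer (- (x + real k)) (Suc k)) * pochhammer (1 - x) M
      = pi * (-1) ^ Suc k * pochhammer (- (x + real k)) (Suc k + M)"
    unfolding pochhammer_product' by (simp add: algebra_simps)
  finally show ?thesis unfolding fexp_Jfps_nth by (simp add: N add.commute)
qed

text \<open>Multiplying by \<open>exp (- k J) = (1 - X)\<^sup>k\<close> turns \<open>J\<^sup>k\<close> into \<open>((1 - X) J)\<^sup>k = X\<^sup>k (1 - K)\<^sup>k\<close>.\<close>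

lemma Jfps_power_mult_fexp:
  "Jfps ^ k * fexp (fps_const (- (c + real k)) * Jfps) = fps_X ^ k * ((1 - Kfps) ^ k * fexp (fps_const (- c) * Jfps))"
proof (induction k)
  case (Suc k)
  have "fexp (fps_const (- (c + real (Suc k))) * Jfps) = fexp (- Jfps + fps_const (- (c + real k)) * Jfps)"
    by (rule arg_cong[of _ _ fexp], rule fps_ext) (simp add: algebra_simps add_divide_distrib)
  also have "\<dots> = (1 - fps_X) * fexp (fps_const (- (c + real k)) * Jfps)"
    unfolding fexp_uminus_Jfps[symmetric] by (rule fexp_add) auto
  finally have "fexp (fps_const (- (c + real (Suc k))) * Jfps) = (1 - fps_X) * fexp (fps_const (- (c + real k)) * Jfps)" .
  then have "Jfps ^ Suc k * fexp (fps_const (- (c + real (Suc k))) * Jfps)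
      = ((1 - fps_X) * Jfps) * (Jfps ^ k * fexp (fps_const (- (c + real k)) * Jfps))"
    by (simp only: power_Suc mult_ac)
  then show ?case unfolding Suc.IH Jfps_Kfps by (simp add: mult_ac)
qed simp

text \<open>Both sides are the coefficient of \<open>h\<^sup>k\<close> in one function of a small real \<open>h\<close>, namely the integral with \<open>c\<close>
  shifted to \<open>c + h\<close>.  Expanding under the integral gives the left side.  Evaluating the integral as a Beta
  value gives the coefficient of \<open>X\<^sup>N\<^sup>+\<^sup>k\<close> in \<open>exp (- h J) exp (- (c + k) J)\<close>, a polynomial in \<open>h\<close>, and hence the
  right side.\<close>

lemma LBINT_beta_kernel_osc_coeff:
  assumes c: "0 \<le> c" "c < 1" and N: "N \<ge> 3"
  shows "(LBINT s:{0<..<1}. beta_kernel (real k + c) (real N - 1 - c) s * osc_coeff c k s)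
       = - pi / fact k * ((1 - Kfps) ^ k * fexp (fps_const (- c) * Jfps)) $ N"
proof -
  define f where "f = beta_kernel (real k + c) (real N - 1 - c)"
  define Y where "Y j = (LBINT s:{0<..<1}. f s * osc_coeff c j s)" for j
  define M where "M = N + k"
  define W where "W = fexp (fps_const (- (c + real k)) * Jfps)"
  \<comment> \<open>The coefficients of \<open>\<pi> (-1)\<^sup>k\<^sup>+\<^sup>1 [X\<^sup>M] exp (- h J) W\<close> as a polynomial in \<open>h\<close>.\<close>
  define e where "e j = (if j \<le> M then pi * (-1) ^ Suc k * ((-1) ^ j / fact j * (Jfps ^ j * W) $ M) else 0)" for j
  have "Y k - e k = 0"
  proof (rule powser_zero_imp_coeff_zero[where r = 1])
    fix h :: real assume h: "\<bar>h\<bar> < 1"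
    have "(\<lambda>j. LBINT s:{0<..<1}. f s * (osc_coeff c j s * h ^ j)) sums
        (LBINT s:{0<..<1}. f s * (exp (h * logit s) * sin (pi * (c + h))))"
    proof (rule set_integral_sums_dominated)
      \<comment> \<open>Both signs of \<open>logit s\<close> are covered by adding the two tilts; \<open>\<bar>h\<bar> < 1\<close> keeps all exponents above \<open>- 1\<close>.\<close>
      let ?g = "\<lambda>s. exp (\<bar>h\<bar> * pi) * (beta_kernel (real k + c + \<bar>h\<bar>) (real N - 1 - c - \<bar>h\<bar>) s
                  + beta_kernel (real k + c - \<bar>h\<bar>) (real N - 1 - c + \<bar>h\<bar>) s)"
      show "set_integrable lborel {0<..<1} ?g"
        using h c N by (intro set_integrable_mult_right set_integral_add(1) set_integrable_beta_kernel) auto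
      fix s :: real assume s: "s \<in> {0<..<1}"
      have f: "0 \<le> f s" by (simp add: f_def beta_kernel_nonneg)
      show "(\<lambda>j. f s * (osc_coeff c j s * h ^ j)) sums (f s * (exp (h * logit s) * sin (pi * (c + h))))"
        by (intro sums_mult osc_coeff_sums)
      fix n
      have "(\<Sum>j<n. \<bar>f s * (osc_coeff c j s * h ^ j)\<bar>) = f s * (\<Sum>j<n. \<bar>osc_coeff c j s * h ^ j\<bar>)"
        using f by (simp add: abs_mult sum_distrib_left)
      also have "\<dots> \<le> f s * exp (\<bar>h\<bar> * (\<bar>logit s\<bar> + pi))"
        by (rule mult_left_mono[OF osc_coeff_abs_sum_le f])
      also have "\<dots> = exp (\<bar>h\<bar> * pi) * (exp (\<bar>h\<bar> * \<bar>logit s\<bar>) * f s)"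
        by (simp add: distrib_left exp_add mult_ac)
      also have "exp (\<bar>h\<bar> * \<bar>logit s\<bar>) * f s \<le> (exp (\<bar>h\<bar> * logit s) + exp (- \<bar>h\<bar> * logit s)) * f s"
        using f by (intro mult_right_mono) (auto simp: abs_if)
      also have "\<dots> = exp (\<bar>h\<bar> * logit s) * f s + exp (- \<bar>h\<bar> * logit s) * f s"
        by (rule distrib_right)
      also have "\<dots> = beta_kernel (real k + c + \<bar>h\<bar>) (real N - 1 - c - \<bar>h\<bar>) s
                  + beta_kernel (real k + c - \<bar>h\<bar>) (real N - 1 - c + \<bar>h\<bar>) s"
        unfolding f_def using s by (subst (1 2) beta_kernel_exp_logit) auto
      finally show "(\<Sum>j<n. \<bar>f s * (osc_coeff c j s * h ^ j)\<bar>) \<le> ?g s" by simp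
    qed (auto simp: f_def)
    also have "(\<lambda>j. LBINT s:{0<..<1}. f s * (osc_coeff c j s * h ^ j)) = (\<lambda>j. Y j * h ^ j)"
      by (simp add: Y_def flip: mult.assoc)
    also have "(LBINT s:{0<..<1}. f s * (exp (h * logit s) * sin (pi * (c + h))))
        = (LBINT s:{0<..<1}. sin (pi * (c + h)) * beta_kernel (real k + c + h) (real N - 1 - c - h) s)"
      by (rule set_lebesgue_integral_cong) (auto simp: f_def mult_ac simp flip: beta_kernel_exp_logit)
    also have "\<dots> = sin (pi * (c + h)) * Beta (real k + c + h + 1) (real N - 1 - c - h + 1)"
      using h c N by (simp add: LBINT_beta_kernel)
    also have "\<dots> = sin (pi * (c + h)) * Beta (c + h + real k + 1) (real N - (c + h))"
      by (simp add: algebra_simps)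
    also have "\<dots> = pi * (-1) ^ Suc k * fexp (fps_const (- (c + h + real k)) * Jfps) $ M"
      unfolding M_def using h c N by (intro sin_mult_Beta) auto
    also have "fexp (fps_const (- (c + h + real k)) * Jfps) = fexp (fps_const (- h) * Jfps) * W"
    proof -
      have "fps_const (- (c + h + real k)) * Jfps = fps_const (- h) * Jfps + fps_const (- (c + real k)) * Jfps"
        by (rule fps_ext) (simp add: algebra_simps add_divide_distrib)
      then show ?thesis by (simp add: fexp_add W_def)
    qed
    also have "pi * (-1) ^ Suc k * (fexp (fps_const (- h) * Jfps) * W) $ M = (\<Sum>j\<in>{..M}. e j * h ^ j)"
      unfolding sum_distrib_left
      by (subst fexp_scale_mult_nth) (auto simp: sum_distrib_left e_def power_minus[of h] mult_ac intro!: sum.cong)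
    finally have "(\<lambda>j. Y j * h ^ j) sums (\<Sum>j\<in>{..M}. e j * h ^ j)" .
    moreover have "(\<lambda>j. e j * h ^ j) sums (\<Sum>j\<in>{..M}. e j * h ^ j)"
      by (rule sums_finite) (auto simp: e_def)
    ultimately have "(\<lambda>j. Y j * h ^ j - e j * h ^ j) sums 0"
      using sums_diff by fastforce
    then show "(\<lambda>j. (Y j - e j) * h ^ j) sums 0" by (simp add: algebra_simps)
  qed simp
  then have "Y k = pi * (-1) ^ Suc k * ((-1) ^ k / fact k * (Jfps ^ k * W) $ M)"
    by (simp add: e_def M_def)
  also have "\<dots> = - pi / fact k * (Jfps ^ k * W) $ M"
    by (simp flip: power_mult_distrib mult.assoc)
  also have "(Jfps ^ k * W) $ M = ((1 - Kfps) ^ k * fexp (fps_const (- c) * Jfps)) $ N"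
    unfolding W_def Jfps_power_mult_fexp M_def by (simp add: fps_X_power_mult_nth)
  finally show ?thesis by (simp add: Y_def f_def)
qed

text \<open>Formally \<open>exp (a (1 - U)) = e\<^sup>a exp (- a U)\<close>.  As \<open>1 - U\<close> has a constant term, the left side is a genuine
  infinite series in each coefficient.  It is the Cauchy product of the numerical series for \<open>e\<^sup>a\<close> with a finite
  sum, by the binomial theorem.\<close>

lemma exp_shifted_fexp_sums:
  assumes "U $ 0 = 0"
  shows "(\<lambda>k. a ^ k / fact k * ((1 - U) ^ k * W) $ N) sums (exp a * (fexp (fps_const (- a) * U) * W) $ N)"
proof -
  define b where "b i = (if i \<le> N then (- a) ^ i / fact i * (U ^ i * W) $ N else 0)" for i
  have z: "(U ^ i * W) $ N = 0" if "N < i" for i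
    unfolding fps_mult_nth using assms that by (intro sum.neutral) (auto simp: startsby_zero_power_prefix)
  have b: "b i = (- a) ^ i / fact i * (U ^ i * W) $ N" for i
    using z[of i] by (auto simp: b_def not_le)
  have bs: "summable (\<lambda>i. norm (b i))"
    by (rule summable_finite[of "{..N}"]) (auto simp: b_def)
  have "suminf b = (\<Sum>i\<le>N. b i)"
    by (rule suminf_finite) (auto simp: b_def)
  also have "\<dots> = (fexp (fps_const (- a) * U) * W) $ N"
    unfolding fexp_scale_mult_nth[OF assms] by (simp add: b_def)
  finally have sb: "suminf b = (fexp (fps_const (- a) * U) * W) $ N" .
  have "(\<lambda>k. \<Sum>i\<le>k. a ^ i /\<^sub>R fact i * b (k - i)) sums ((\<Sum>k. a ^ k /\<^sub>R fact k) * suminf b)"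
    by (rule Cauchy_product_sums[OF summable_norm_exp bs])
  also have "(\<Sum>k. a ^ k /\<^sub>R fact k) = exp a" by (rule sums_unique[OF exp_converges, symmetric])
  also have "(\<lambda>k. \<Sum>i\<le>k. a ^ i /\<^sub>R fact i * b (k - i)) = (\<lambda>k. a ^ k / fact k * ((1 - U) ^ k * W) $ N)"
  proof
    fix k
    have "(1 - U) ^ k * W = (\<Sum>i\<le>k. fps_const (real (k choose i) * (-1) ^ (k - i)) * (U ^ (k - i) * W))"
    proof -
      have "(- U) ^ m = fps_const ((-1) ^ m) * U ^ m" for m
        by (cases "even m") (auto simp flip: fps_const_neg)
      then show ?thesis
        using binomial_ring[of 1 "- U" k]
        by (simp add: sum_distrib_right fps_of_nat[symmetric] mult.assoc flip: fps_const_mult)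
    qed
    then have "a ^ k / fact k * ((1 - U) ^ k * W) $ N
        = (\<Sum>i\<le>k. a ^ k / fact k * (of_nat (k choose i) * ((-1) ^ (k - i) * (U ^ (k - i) * W) $ N)))"
      by (simp add: fps_sum_nth sum_distrib_left mult.assoc del: fps_const_mult)
    also have "\<dots> = (\<Sum>i\<le>k. a ^ i /\<^sub>R fact i * b (k - i))"
    proof (rule sum.cong[OF refl])
      fix i assume "i \<in> {..k}"
      then have i: "i \<le> k" by simp
      have "a ^ k = a ^ i * a ^ (k - i)" using i by (simp flip: power_add)
      moreover have "(- a) ^ (k - i) = (-1) ^ (k - i) * a ^ (k - i)" by (rule power_minus)
      moreover have "real (k choose i) = fact k / (fact i * fact (k - i))" by (rule binomial_fact[OF i])
      ultimately show "a ^ k / fact k * (of_nat (k choose i) * ((-1) ^ (k - i) * (U ^ (k - i) * W) $ N))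
          = a ^ i /\<^sub>R fact i * b (k - i)"
        unfolding b by (simp add: field_simps)
    qed
    finally show "(\<Sum>i\<le>k. a ^ i /\<^sub>R fact i * b (k - i)) = a ^ k / fact k * ((1 - U) ^ k * W) $ N" by simp
  qed
  finally show ?thesis unfolding sb .
qed

text \<open>At \<open>s = 0\<close> the logarithmic singularity is damped by the factor \<open>s\<close>; at \<open>s = 1\<close> it costs the exponent \<open>a\<close>.
  This loss is the reason for the condition \<open>a + c < 3\<close>.\<close>

lemma exp_logit_beta_kernel_le:
  assumes a: "0 \<le> a" and s: "0 < s" "s < 1"
  shows "exp (a * s * \<bar>logit s\<bar>) * beta_kernel p q s \<le> exp a * beta_kernel p (q - a) s"
proof -
  have "- ln s \<le> 1 / s - 1" using ln_le_minus_one[of "1 / s"] s by (simp add: ln_div)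
  then have "s * - ln s \<le> s * (1 / s - 1)" using s by (intro mult_left_mono) auto
  also have "\<dots> \<le> 1" using s by (simp add: algebra_simps)
  finally have 1: "s * - ln s \<le> 1" .
  have "s * - ln (1 - s) \<le> 1 * - ln (1 - s)" using s by (intro mult_right_mono) auto
  moreover have "s * \<bar>logit s\<bar> \<le> s * - ln s + s * - ln (1 - s)"
  proof -
    have "\<bar>logit s\<bar> \<le> - ln s + - ln (1 - s)"
      using s by (simp add: logit_def ln_div abs_le_iff)
    then have "s * \<bar>logit s\<bar> \<le> s * (- ln s + - ln (1 - s))"
      using s by (intro mult_left_mono) auto
    then show ?thesis by (simp only: distrib_left)
  qed
  ultimately have "s * \<bar>logit s\<bar> \<le> 1 + - ln (1 - s)" using 1 by linarith
  then have "a * (s * \<bar>logit s\<bar>) \<le> a * (1 + - ln (1 - s))" by (rule mult_left_mono[OF _ a])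
  then have "exp (a * s * \<bar>logit s\<bar>) \<le> exp (a + a * - ln (1 - s))" by (simp add: algebra_simps)
  then have "exp (a * s * \<bar>logit s\<bar>) * beta_kernel p q s \<le> exp (a + a * - ln (1 - s)) * beta_kernel p q s"
    by (rule mult_right_mono[OF _ beta_kernel_nonneg])
  also have "\<dots> = exp a * beta_kernel p (q - a) s"
    using s by (simp add: beta_kernel_def powr_def algebra_simps flip: exp_add)
  finally show ?thesis .
qed

lemma wfun_beta_kernel:
  assumes s: "0 < s" "s < 1"
  shows "wfun a c s * (1 - s) ^ n
       = 1 / pi * (beta_kernel c (real n - c) s * (exp (a * s * logit s) * sin (pi * (c + a * s))))"
proof -
  have "(s / (1 - s)) powr (a * s + c) * (1 - s) ^ n
      = exp (a * s * logit s) * (exp (c * logit s) * beta_kernel 0 (real n) s)"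
    using s by (simp add: odds_powr beta_kernel_def powr_realpow distrib_right exp_add)
  also have "\<dots> = exp (a * s * logit s) * beta_kernel c (real n - c) s"
    using s by (simp add: beta_kernel_exp_logit)
  finally show ?thesis by (simp add: wfun_def mult_ac add.commute)
qed

lemma borel_measurable_wfun [measurable]: "wfun a c \<in> borel_measurable borel"
  unfolding wfun_def[abs_def] by measurable

text \<open>Expansion in powers of \<open>a s\<close> under the integral.  The exponent of \<open>1 - s\<close> in the dominating function is
  \<open>N - 1 - c - a\<close>, which exceeds \<open>- 1\<close> as \<open>N \<ge> 3 > a + c\<close>.\<close>

lemma LBINT_wfun_moment:
  assumes ac: "(a, c) \<in> param_dom" and N: "N \<ge> 3"
  shows "(LBINT s:{0<..<1}. wfun a c s * (1 - s) ^ (N - 1)) = - exp a * resolvent_fps a c $ N"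
proof -
  have a: "0 < a" and c: "0 \<le> c" "c < 1" and ac: "a + c < 3"
    using ac by (auto simp: param_dom_def)
  define f where "f = beta_kernel c (real N - 1 - c)"
  have "(\<lambda>k. LBINT s:{0<..<1}. f s * (osc_coeff c k s * (a * s) ^ k)) sums
      (LBINT s:{0<..<1}. f s * (exp (a * s * logit s) * sin (pi * (c + a * s))))"
  proof (rule set_integral_sums_dominated)
    let ?g = "\<lambda>s. exp (a * pi) * (exp a * beta_kernel c (real N - 1 - c - a) s)"
    show "set_integrable lborel {0<..<1} ?g"
      using a c N ac by (intro set_integrable_mult_right set_integrable_beta_kernel) auto
    fix s :: real assume s: "s \<in> {0<..<1}"
    have f: "0 \<le> f s" by (simp add: f_def beta_kernel_nonneg)
    show "(\<lambda>k. f s * (osc_coeff c k s * (a * s) ^ k)) sums (f s * (exp (a * s * logit s) * sin (pi * (c + a * s))))"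
      by (intro sums_mult osc_coeff_sums)
    fix n
    have "(\<Sum>k<n. \<bar>f s * (osc_coeff c k s * (a * s) ^ k)\<bar>) = f s * (\<Sum>k<n. \<bar>osc_coeff c k s * (a * s) ^ k\<bar>)"
      using f by (simp add: abs_mult sum_distrib_left)
    also have "\<dots> \<le> f s * exp (\<bar>a * s\<bar> * (\<bar>logit s\<bar> + pi))"
      by (rule mult_left_mono[OF osc_coeff_abs_sum_le f])
    also have "\<dots> = exp (a * s * pi) * (exp (a * s * \<bar>logit s\<bar>) * f s)"
      using a s by (simp add: distrib_left exp_add mult_ac)
    also have "\<dots> \<le> exp (a * pi) * (exp a * beta_kernel c (real N - 1 - c - a) s)"
      unfolding f_def using a s by (intro mult_mono exp_logit_beta_kernel_le) (auto simp: beta_kernel_nonneg)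
    finally show "(\<Sum>k<n. \<bar>f s * (osc_coeff c k s * (a * s) ^ k)\<bar>) \<le> ?g s" .
  qed (auto simp: f_def)
  also have "(LBINT s:{0<..<1}. f s * (exp (a * s * logit s) * sin (pi * (c + a * s))))
      = (LBINT s:{0<..<1}. pi * (wfun a c s * (1 - s) ^ (N - 1)))"
    using N by (intro set_lebesgue_integral_cong) (auto simp: wfun_beta_kernel f_def of_nat_diff)
  also have "\<dots> = pi * (LBINT s:{0<..<1}. wfun a c s * (1 - s) ^ (N - 1))"
    by simp
  also have "(\<lambda>k. LBINT s:{0<..<1}. f s * (osc_coeff c k s * (a * s) ^ k))
      = (\<lambda>k. - pi * (a ^ k / fact k * ((1 - Kfps) ^ k * fexp (fps_const (- c) * Jfps)) $ N))"
  proof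
    fix k
    have "(LBINT s:{0<..<1}. f s * (osc_coeff c k s * (a * s) ^ k))
        = (LBINT s:{0<..<1}. a ^ k * (beta_kernel (real k + c) (real N - 1 - c) s * osc_coeff c k s))"
    proof (intro set_lebesgue_integral_cong allI impI)
      fix s :: real assume "s \<in> {0<..<1}"
      then show "f s * (osc_coeff c k s * (a * s) ^ k) = a ^ k * (beta_kernel (real k + c) (real N - 1 - c) s * osc_coeff c k s)"
        using beta_kernel_power[of s 0 k c "real N - 1 - c"]
        by (auto simp: f_def power_mult_distrib add.commute[of c] mult_ac)
    qed simp
    also have "\<dots> = a ^ k * (- pi / fact k * ((1 - Kfps) ^ k * fexp (fps_const (- c) * Jfps)) $ N)"
      by (simp add: LBINT_beta_kernel_osc_coeff[OF c N])
    finally show "(LBINT s:{0<..<1}. f s * (osc_coeff c k s * (a * s) ^ k))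
        = - pi * (a ^ k / fact k * ((1 - Kfps) ^ k * fexp (fps_const (- c) * Jfps)) $ N)" by simp
  qed
  finally have "(\<lambda>k. - pi * (a ^ k / fact k * ((1 - Kfps) ^ k * fexp (fps_const (- c) * Jfps)) $ N)) sums
      (pi * (LBINT s:{0<..<1}. wfun a c s * (1 - s) ^ (N - 1)))" .
  moreover have "(\<lambda>k. - pi * (a ^ k / fact k * ((1 - Kfps) ^ k * fexp (fps_const (- c) * Jfps)) $ N)) sums
      (- pi * (exp a * resolvent_fps a c $ N))"
    unfolding resolvent_fps_split by (intro sums_mult exp_shifted_fexp_sums) simp
  ultimately have "pi * (LBINT s:{0<..<1}. wfun a c s * (1 - s) ^ (N - 1)) = - pi * (exp a * resolvent_fps a c $ N)"
    by (rule sums_unique2)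
  then have "pi * (LBINT s:{0<..<1}. wfun a c s * (1 - s) ^ (N - 1)) = pi * (- exp a * resolvent_fps a c $ N)"
    by simp
  then show ?thesis by (subst (asm) mult_left_cancel) auto
qed

section \<open>The density as a power series\<close>

lemma density_fps_0: "density_fps a c $ 0 = q1 a c"
  and density_fps_1: "density_fps a c $ 1 = q1 a c - q2 a c"
proof -
  have G1: "resolvent_fps a c $ 1 = - (a / 2 + c)"
    using arg_cong[OF fps_deriv_resolvent_fps[of a c], of "\<lambda>f. f $ 0"]
    by (simp add: kernel_fps_def)
  have "2 * resolvent_fps a c $ 2 = - ((a / 2 + c) * resolvent_fps a c $ 1 + (a / 3 + c))"
    using arg_cong[OF fps_deriv_resolvent_fps[of a c], of "\<lambda>f. f $ 1"]
    by (simp add: kernel_fps_def fps_mult_nth_1 numeral_2_eq_2)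
  then have G2: "resolvent_fps a c $ 2 = (a / 2 + c)\<^sup>2 / 2 - a / 6 - c / 2"
    unfolding G1 by (simp add: power2_eq_square field_simps)
  show "density_fps a c $ 0 = q1 a c"
    using G1 by (simp add: density_fps_def q1_def)
  show "density_fps a c $ 1 = q1 a c - q2 a c"
    using G2 by (simp add: density_fps_def q1_def q2_def numeral_2_eq_2)
qed

text \<open>The subtracted terms \<open>1 + (1 - s) t\<close> leave a factor \<open>(1 - s)\<^sup>2\<close> in every summand, just enough for
  integrability at \<open>s = 1\<close>.\<close>

lemma wfun_exp_tail_sums:
  assumes ac: "(a, c) \<in> param_dom"
  shows "(\<lambda>n. LBINT s:{0<..<1}. t ^ (n + 2) / fact (n + 2) * (wfun a c s * (1 - s) ^ (n + 2)))
    sums (LBINT s:{0<..<1}. wfun a c s * (exp ((1 - s) * t) - 1 - (1 - s) * t))"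
proof (rule set_integral_sums_dominated)
  have a: "0 < a" and c: "0 \<le> c" "c < 1" and ac: "a + c < 3"
    using ac by (auto simp: param_dom_def)
  let ?g = "\<lambda>s. exp \<bar>t\<bar> * (1 / pi * (exp a * beta_kernel c (2 - c - a) s))"
  show "set_integrable lborel {0<..<1} ?g"
    using a c ac by (intro set_integrable_mult_right set_integrable_beta_kernel) auto
  fix s :: real assume s: "s \<in> {0<..<1}"
  have "(\<lambda>n. ((1 - s) * t) ^ (n + 2) / fact (n + 2)) sums
      (exp ((1 - s) * t) - (\<Sum>i<2. ((1 - s) * t) ^ i / fact i))"
    using sums_split_initial_segment[OF exp_converges[of "(1 - s) * t"], of 2] by (simp add: field_simps)
  then have "(\<lambda>n. ((1 - s) * t) ^ (n + 2) / fact (n + 2)) sums (exp ((1 - s) * t) - 1 - (1 - s) * t)"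
    by (simp add: eval_nat_numeral algebra_simps)
  from sums_mult[OF this, of "wfun a c s"]
  show "(\<lambda>n. t ^ (n + 2) / fact (n + 2) * (wfun a c s * (1 - s) ^ (n + 2)))
      sums (wfun a c s * (exp ((1 - s) * t) - 1 - (1 - s) * t))"
    by (simp add: power_mult_distrib mult_ac)
  fix n
  have w: "\<bar>wfun a c s * (1 - s)\<^sup>2\<bar> \<le> 1 / pi * (exp a * beta_kernel c (2 - c - a) s)"
  proof -
    have "\<bar>wfun a c s * (1 - s)\<^sup>2\<bar>
        = 1 / pi * (beta_kernel c (2 - c) s * (exp (a * s * logit s) * \<bar>sin (pi * (c + a * s))\<bar>))"
      using s by (subst wfun_beta_kernel) (auto simp: abs_mult beta_kernel_nonneg)
    also have "\<dots> \<le> 1 / pi * (beta_kernel c (2 - c) s * (exp (a * s * \<bar>logit s\<bar>) * 1))"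
      using a s by (intro mult_left_mono mult_mono) (auto simp: beta_kernel_nonneg)
    also have "\<dots> = 1 / pi * (exp (a * s * \<bar>logit s\<bar>) * beta_kernel c (2 - c) s)"
      by simp
    also have "\<dots> \<le> 1 / pi * (exp a * beta_kernel c (2 - c - a) s)"
      using a s by (intro mult_left_mono exp_logit_beta_kernel_le) auto
    finally show ?thesis .
  qed
  have "(\<Sum>i<n. \<bar>t ^ (i + 2) / fact (i + 2) * (wfun a c s * (1 - s) ^ (i + 2))\<bar>)
      \<le> (\<Sum>i<n. \<bar>t\<bar> ^ (i + 2) / fact (i + 2) * (1 / pi * (exp a * beta_kernel c (2 - c - a) s)))"
  proof (rule sum_mono)
    fix i
    have "\<bar>wfun a c s * (1 - s) ^ (i + 2)\<bar> = (1 - s) ^ i * \<bar>wfun a c s * (1 - s)\<^sup>2\<bar>"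
      using s by (simp add: abs_mult power_add power2_eq_square)
    also have "\<dots> \<le> 1 * (1 / pi * (exp a * beta_kernel c (2 - c - a) s))"
      using s w by (intro mult_mono) (auto intro: power_le_one)
    finally have "\<bar>wfun a c s * (1 - s) ^ (i + 2)\<bar> \<le> 1 / pi * (exp a * beta_kernel c (2 - c - a) s)"
      by simp
    then show "\<bar>t ^ (i + 2) / fact (i + 2) * (wfun a c s * (1 - s) ^ (i + 2))\<bar>
        \<le> \<bar>t\<bar> ^ (i + 2) / fact (i + 2) * (1 / pi * (exp a * beta_kernel c (2 - c - a) s))"
      unfolding abs_mult[of "t ^ (i + 2) / fact (i + 2)"] abs_divide power_abs
      by (intro mult_mono) auto
  qed
  also have "\<dots> = (\<Sum>i<n. \<bar>t\<bar> ^ (i + 2) / fact (i + 2)) * (1 / pi * (exp a * beta_kernel c (2 - c - a) s))"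
    by (rule sum_distrib_right[symmetric])
  also have "\<dots> \<le> ?g s"
  proof (rule mult_right_mono)
    have "(\<Sum>i<n. \<bar>t\<bar> ^ (i + 2) / fact (i + 2)) = (\<Sum>i=2..<n+2. \<bar>t\<bar> ^ i /\<^sub>R fact i)"
      using sum.shift_bounds_nat_ivl[of "\<lambda>i. inverse (fact i) * \<bar>t\<bar> ^ i" 0 2 n]
      unfolding divide_inverse_commute real_scaleR_def by (simp only: atLeast0LessThan add_0_left)
    also have "\<dots> \<le> (\<Sum>i. \<bar>t\<bar> ^ i /\<^sub>R fact i)"
      by (intro sum_le_suminf sums_summable[OF exp_converges]) auto
    also have "\<dots> = exp \<bar>t\<bar>" by (rule sums_unique[OF exp_converges, symmetric])
    finally show "(\<Sum>i<n. \<bar>t\<bar> ^ (i + 2) / fact (i + 2)) \<le> exp \<bar>t\<bar>" .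
  qed (simp add: beta_kernel_nonneg)
  finally show "(\<Sum>i<n. \<bar>t ^ (i + 2) / fact (i + 2) * (wfun a c s * (1 - s) ^ (i + 2))\<bar>) \<le> ?g s" .
qed measurable

text \<open>The moments with exponents \<open>n + 2\<close> supply the coefficients from the second one on; the first two are the
  terms with \<open>q1\<close> and \<open>q2\<close>, which the power series \<open>G\<close> reproduces.\<close>

lemma Dfun_eq_egf:
  assumes ac: "(a, c) \<in> param_dom"
  shows "Dfun a c t = egf (density_fps a c) t"
proof -
  let ?I = "LBINT s:{0<..<1}. wfun a c s * (exp ((1 - s) * t) - 1 - (1 - s) * t)"
  have "(LBINT s:{0<..<1}. t ^ (n + 2) / fact (n + 2) * (wfun a c s * (1 - s) ^ (n + 2)))
      = exp a * (density_fps a c $ (n + 2) * t ^ (n + 2) / fact (n + 2))" for n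
  proof -
    have "(LBINT s:{0<..<1}. t ^ (n + 2) / fact (n + 2) * (wfun a c s * (1 - s) ^ (n + 2)))
        = t ^ (n + 2) / fact (n + 2) * (LBINT s:{0<..<1}. wfun a c s * (1 - s) ^ (n + 3 - 1))"
      by (subst set_integral_mult_right) (simp add: numeral_eq_Suc)
    also have "\<dots> = t ^ (n + 2) / fact (n + 2) * (exp a * density_fps a c $ (n + 2))"
      by (subst LBINT_wfun_moment[OF ac]) (simp_all add: density_fps_def numeral_eq_Suc)
    finally show ?thesis by simp
  qed
  then have exp_sums: "(\<lambda>n. exp a * (density_fps a c $ (n + 2) * t ^ (n + 2) / fact (n + 2))) sums ?I"
    using wfun_exp_tail_sums[OF ac, of t] by (simp only:)
  have "(\<lambda>n. density_fps a c $ (n + 2) * t ^ (n + 2) / fact (n + 2)) sums (exp (- a) * ?I)"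
  proof -
    have "exp (- a) * (exp a * x) = x" for x :: real by (simp add: exp_minus)
    with sums_mult[OF exp_sums, of "exp (- a)"] show ?thesis by (simp only:)
  qed
  then have "(\<lambda>n. density_fps a c $ n * t ^ n / fact n) sums
      (exp (- a) * ?I + (\<Sum>n<2. density_fps a c $ n * t ^ n / fact n))"
    by (subst (asm) sums_iff_shift) simp
  then have "egf (density_fps a c) t = exp (- a) * ?I + (\<Sum>n<2. density_fps a c $ n * t ^ n / fact n)"
    by (rule egf_eqI)
  also have "(\<Sum>n<2. density_fps a c $ n * t ^ n / fact n) = q1 a c + (q1 a c - q2 a c) * t"
    using density_fps_0[of a c] density_fps_1[of a c] by (simp add: numeral_2_eq_2)
  finally show ?thesis by (simp add: Dfun_def)
qed

lemma mfun_eq_density_series: "(a, c) \<in> param_dom \<Longrightarrow> mfun a c t = density_series a c t"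
  by (simp add: mfun_def density_series_def Dfun_eq_egf)

section \<open>Uniform differentiability in the parameters\<close>

lemma abs_resolvent_mult_le:
  assumes F: "geom_bound C F" and C: "1 \<le> C" and ac: "1 + (\<bar>a\<bar> + \<bar>c\<bar>) \<le> C" and t: "0 \<le> t" "t \<le> T"
  shows "\<bar>resolvent_mult F a c t\<bar> \<le> 2 * C\<^sup>2 * exp (2 * C\<^sup>2 * T)"
proof -
  have "\<bar>resolvent_mult F a c t\<bar> = exp (- t) * \<bar>egf (F * resolvent_fps a c) t\<bar>"
    by (simp add: resolvent_mult_def abs_mult)
  also have "\<dots> \<le> 1 * \<bar>egf (F * resolvent_fps a c) t\<bar>"
    using t by (intro mult_right_mono) auto
  also have "\<dots> \<le> 2 * C\<^sup>2 * exp (2 * C\<^sup>2 * T)"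
    using abs_egf_le[OF geom_bound_mult_resolvent_fps[OF F C ac], of t T] t by simp
  finally show ?thesis .
qed

lemma Lipschitz_of_bounded_deriv:
  fixes f f' :: "real \<Rightarrow> real"
  assumes d: "\<And>z. (f has_real_derivative f' z) (at z)"
    and b: "\<And>z. z \<in> closed_segment x y \<Longrightarrow> \<bar>f' z\<bar> \<le> M"
  shows "\<bar>f y - f x\<bar> \<le> M * \<bar>y - x\<bar>"
  using field_differentiable_bound[of "closed_segment x y" f f' M y x]
    has_field_derivative_at_within[OF d] b by simp

lemma geom_bound_mult_Kfps:
  "geom_bound C F \<Longrightarrow> 1 \<le> C \<Longrightarrow> geom_bound (2 * C\<^sup>2) (F * Kfps)"
proof (rule geom_bound_mult[OF _ geom_bound_1I])
  show "\<bar>Kfps $ n\<bar> \<le> 1" for n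
    by (cases n) (auto simp: divide_simps intro: mult_ge1_I)
qed

lemma geom_bound_mult_Jfps:
  "geom_bound C F \<Longrightarrow> 1 \<le> C \<Longrightarrow> geom_bound (2 * C\<^sup>2) (F * Jfps)"
  by (rule geom_bound_mult) (auto intro!: geom_bound_1I simp: divide_simps)

text \<open>The partial derivatives are of the same form with multipliers \<open>- F K\<close> and \<open>- F J\<close>, hence bounded near
  \<open>(a, c)\<close> uniformly for \<open>t\<close> in \<open>{0..T}\<close>.\<close>

lemma resolvent_mult_Lipschitz:
  assumes F: "geom_bound C F" and C: "1 \<le> C"
  shows "\<exists>M\<ge>0. \<forall>a' c' t. \<bar>a' - a\<bar> \<le> 1 \<longrightarrow> \<bar>c' - c\<bar> \<le> 1 \<longrightarrow> t \<in> {0..T} \<longrightarrow>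
           \<bar>resolvent_mult F a' c' t - resolvent_mult F a c t\<bar> \<le> M * (\<bar>a' - a\<bar> + \<bar>c' - c\<bar>)"
proof -
  \<comment> \<open>Parameters at distance at most \<open>1\<close> in each coordinate satisfy \<open>1 + (\<bar>a'\<bar> + \<bar>c'\<bar>) \<le> D\<close>.\<close>
  define D where "D = max (2 * C\<^sup>2) (3 + (\<bar>a\<bar> + \<bar>c\<bar>))"
  define M where "M = 2 * D\<^sup>2 * exp (2 * D\<^sup>2 * T)"
  have D: "1 \<le> D" by (simp add: D_def)
  have C2: "C \<le> 2 * C\<^sup>2"
    using C mult_mono[of 1 C C C] by (simp add: power2_eq_square)
  have K: "geom_bound (2 * C\<^sup>2) (F * Kfps)" and J: "geom_bound (2 * C\<^sup>2) (F * Jfps)"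
    using geom_bound_mult_Kfps[OF F C] geom_bound_mult_Jfps[OF F C] .
  have F': "geom_bound (2 * C\<^sup>2) F" by (rule geom_bound_mono[OF F C2])
  have bound: "\<bar>resolvent_mult (- H) x y t\<bar> \<le> M"
    if "geom_bound (2 * C\<^sup>2) H" "\<bar>x - a\<bar> \<le> 1" "\<bar>y - c\<bar> \<le> 1" "t \<in> {0..T}" for H x y t
  proof -
    have "1 + (\<bar>x\<bar> + \<bar>y\<bar>) \<le> 3 + (\<bar>a\<bar> + \<bar>c\<bar>)" using that(2,3) by linarith
    then show ?thesis
      unfolding M_def using that D
      by (intro abs_resolvent_mult_le geom_bound_uminus geom_bound_mono[OF that(1)])
        (auto simp: D_def le_max_iff_disj)
  qed
  have "\<bar>resolvent_mult F a' c' t - resolvent_mult F a c t\<bar> \<le> M * (\<bar>a' - a\<bar> + \<bar>c' - c\<bar>)"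
    if a': "\<bar>a' - a\<bar> \<le> 1" and c': "\<bar>c' - c\<bar> \<le> 1" and t: "t \<in> {0..T}" for a' c' t
  proof -
    have "\<bar>resolvent_mult F a' c' t - resolvent_mult F a c' t\<bar> \<le> M * \<bar>a' - a\<bar>"
      by (rule Lipschitz_of_bounded_deriv[OF has_real_derivative_resolvent_mult_a[OF F' K]])
        (use a' c' t in \<open>auto intro!: bound K simp: closed_segment_eq_real_ivl split: if_splits\<close>)
    moreover have "\<bar>resolvent_mult F a c' t - resolvent_mult F a c t\<bar> \<le> M * \<bar>c' - c\<bar>"
      by (rule Lipschitz_of_bounded_deriv[OF has_real_derivative_resolvent_mult_c[OF F' J]])
        (use a' c' t in \<open>auto intro!: bound J simp: closed_segment_eq_real_ivl split: if_splits\<close>)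
    ultimately show ?thesis unfolding distrib_left by linarith
  qed
  moreover have "0 \<le> M" by (simp add: M_def)
  ultimately show ?thesis by blast
qed

lemma uniform_limit_if_dominated:
  fixes f :: "'a \<Rightarrow> 'b \<Rightarrow> real"
  assumes "eventually (\<lambda>x. \<forall>t\<in>S. \<bar>f x t - l t\<bar> \<le> r x) F" and "(r \<longlongrightarrow> 0) F"
  shows "uniform_limit S f l F"
proof (rule uniform_limitI)
  fix e :: real assume "0 < e"
  then have "eventually (\<lambda>x. r x < e) F" using assms(2) by (rule order_tendstoD(2)[rotated])
  with assms(1) show "eventually (\<lambda>x. \<forall>t\<in>S. dist (f x t) (l t) < e) F"
    by eventually_elim (auto simp: dist_real_def)
qed

lemma resolvent_mult_uniform_limit:
  assumes F: "geom_bound C F" and C: "1 \<le> C"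
  shows "uniform_limit {0..T} (\<lambda>(a', c'). resolvent_mult F a' c') (resolvent_mult F a c) (at (a, c) within S)"
proof -
  from resolvent_mult_Lipschitz[OF assms] obtain M where M: "\<And>a' c' t. \<bar>a' - a\<bar> \<le> 1 \<Longrightarrow> \<bar>c' - c\<bar> \<le> 1 \<Longrightarrow> t \<in> {0..T} \<Longrightarrow>
           \<bar>resolvent_mult F a' c' t - resolvent_mult F a c t\<bar> \<le> M * (\<bar>a' - a\<bar> + \<bar>c' - c\<bar>)" by blast
  have lim: "((\<lambda>p. \<bar>fst p - a\<bar> + \<bar>snd p - c\<bar>) \<longlongrightarrow> 0) (at (a, c) within S)"
    by (auto intro!: tendsto_eq_intros)
  show ?thesis
  proof (rule uniform_limit_if_dominated)
    show "((\<lambda>p. M * (\<bar>fst p - a\<bar> + \<bar>snd p - c\<bar>)) \<longlongrightarrow> 0) (at (a, c) within S)"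
      using tendsto_mult_left[OF lim, of M] by simp
    have "eventually (\<lambda>p. \<bar>fst p - a\<bar> + \<bar>snd p - c\<bar> < 1) (at (a, c) within S)"
      by (rule order_tendstoD(2)[OF lim]) simp
    then show "eventually (\<lambda>p. \<forall>t\<in>{0..T}. \<bar>(case p of (a', c') \<Rightarrow> resolvent_mult F a' c') t - resolvent_mult F a c t\<bar>
        \<le> M * (\<bar>fst p - a\<bar> + \<bar>snd p - c\<bar>)) (at (a, c) within S)"
      by eventually_elim (auto simp: split_beta intro!: M)
  qed
qed

lemma difference_quotient_bound:
  fixes f f' :: "real \<Rightarrow> real"
  assumes d: "\<And>z. (f has_real_derivative f' z) (at z)" and xy: "x \<noteq> y"
    and b: "\<And>z. z \<in> closed_segment x y \<Longrightarrow> \<bar>f' z - f' x\<bar> \<le> M"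
  shows "\<bar>(f y - f x) / (y - x) - f' x\<bar> \<le> M"
proof -
  have "\<bar>(f y - f' x * y) - (f x - f' x * x)\<bar> \<le> M * \<bar>y - x\<bar>"
    by (rule Lipschitz_of_bounded_deriv[where f' = "\<lambda>z. f' z - f' x"])
      (auto intro!: derivative_eq_intros d b)
  also have "(f y - f' x * y) - (f x - f' x * x) = ((f y - f x) / (y - x) - f' x) * (y - x)"
    using xy by (simp add: field_simps)
  finally show ?thesis using xy by (simp add: abs_mult)
qed

text \<open>The mean value inequality for \<open>f - f' x\<close> turns a Lipschitz bound on the derivative, uniform in \<open>t\<close>, into a
  uniform rate for the difference quotients.\<close>

lemma uniform_limit_difference_quotient:
  fixes f f' :: "real \<Rightarrow> 'b \<Rightarrow> real"
  assumes d: "\<And>z t. t \<in> S \<Longrightarrow> ((\<lambda>z. f z t) has_real_derivative f' z t) (at z)"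
    and M: "0 \<le> M" "\<And>y t. \<bar>y - x\<bar> \<le> 1 \<Longrightarrow> t \<in> S \<Longrightarrow> \<bar>f' y t - f' x t\<bar> \<le> M * \<bar>y - x\<bar>"
  shows "uniform_limit S (\<lambda>y t. (f y t - f x t) / (y - x)) (f' x) (at x within U)"
proof (rule uniform_limit_if_dominated)
  have lim: "((\<lambda>y. \<bar>y - x\<bar>) \<longlongrightarrow> 0) (at x within U)"
    by (auto intro!: tendsto_eq_intros)
  show "((\<lambda>y. M * \<bar>y - x\<bar>) \<longlongrightarrow> 0) (at x within U)"
    using tendsto_mult_left[OF lim, of M] by simp
  have "eventually (\<lambda>y. \<bar>y - x\<bar> < 1) (at x within U)"
    by (rule order_tendstoD(2)[OF lim]) simp
  moreover have "eventually (\<lambda>y. y \<noteq> x) (at x within U)"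
    by (simp add: eventually_at_filter)
  ultimately show "eventually (\<lambda>y. \<forall>t\<in>S. \<bar>(f y t - f x t) / (y - x) - f' x t\<bar> \<le> M * \<bar>y - x\<bar>) (at x within U)"
  proof eventually_elim
    fix y assume y: "\<bar>y - x\<bar> < 1" "y \<noteq> x"
    show "\<forall>t\<in>S. \<bar>(f y t - f x t) / (y - x) - f' x t\<bar> \<le> M * \<bar>y - x\<bar>"
    proof
      fix t assume t: "t \<in> S"
      show "\<bar>(f y t - f x t) / (y - x) - f' x t\<bar> \<le> M * \<bar>y - x\<bar>"
      proof (rule difference_quotient_bound[where f = "\<lambda>z. f z t" and f' = "\<lambda>z. f' z t", OF d[OF t]])
        fix z assume "z \<in> closed_segment x y"
        then have z: "\<bar>z - x\<bar> \<le> \<bar>y - x\<bar>"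
          by (auto simp: closed_segment_eq_real_ivl split: if_splits)
        then have "\<bar>f' z t - f' x t\<bar> \<le> M * \<bar>z - x\<bar>" using M(2)[OF _ t] y by simp
        also have "\<dots> \<le> M * \<bar>y - x\<bar>" by (rule mult_left_mono[OF z M(1)])
        finally show "\<bar>f' z t - f' x t\<bar> \<le> M * \<bar>y - x\<bar>" .
      qed (use y in auto)
    qed
  qed
qed

text \<open>The power series expression is differentiable at all real parameters and agrees with the density on the
  domain, so the one-sided limits at \<open>c = 0\<close> are restrictions of two-sided ones.\<close>

lemma C1_mfun: "C1_in_params_loc_unif param_dom mfun"
proof -
  have 1: "uniform_limit {0..T} (\<lambda>a' t. (mfun a' c t - mfun a c t) / (a' - a)) (resolvent_mult k_fps a c)
      (at a within {a'. (a', c) \<in> param_dom})"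
    and 2: "uniform_limit {0..T} (\<lambda>c' t. (mfun a c' t - mfun a c t) / (c' - c)) (resolvent_mult j_fps a c)
      (at c within {c'. (a, c') \<in> param_dom})"
    and 3: "uniform_limit {0..T} (\<lambda>(a', c'). resolvent_mult k_fps a' c') (resolvent_mult k_fps a c) (at (a, c) within param_dom)"
    and 4: "uniform_limit {0..T} (\<lambda>(a', c'). resolvent_mult j_fps a' c') (resolvent_mult j_fps a c) (at (a, c) within param_dom)"
    if ac: "(a, c) \<in> param_dom" for T a c
  proof -
    note k = geom_bound_k_fps[OF order_refl] and j = geom_bound_j_fps[OF order_refl]
    show "uniform_limit {0..T} (\<lambda>a' t. (mfun a' c t - mfun a c t) / (a' - a)) (resolvent_mult k_fps a c)
        (at a within {a'. (a', c) \<in> param_dom})"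
    proof -
      from resolvent_mult_Lipschitz[OF k order_refl, of a c T] obtain M where M: "0 \<le> M"
        "\<And>a' c' t. \<bar>a' - a\<bar> \<le> 1 \<Longrightarrow> \<bar>c' - c\<bar> \<le> 1 \<Longrightarrow> t \<in> {0..T} \<Longrightarrow>
             \<bar>resolvent_mult k_fps a' c' t - resolvent_mult k_fps a c t\<bar> \<le> M * (\<bar>a' - a\<bar> + \<bar>c' - c\<bar>)" by blast
      have "uniform_limit {0..T} (\<lambda>a' t. (density_series a' c t - density_series a c t) / (a' - a)) (resolvent_mult k_fps a c)
          (at a within {a'. (a', c) \<in> param_dom})"
        by (rule uniform_limit_difference_quotient[where f = "\<lambda>a. density_series a c" and f' = "\<lambda>a. resolvent_mult k_fps a c", OF has_real_derivative_density_series_a M(1)])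
          (use M(2)[of _ c] in simp)
      then show ?thesis
        by (rule uniform_limit_cong[THEN iffD1, rotated -1])
          (auto simp: eventually_at_filter mfun_eq_density_series ac)
    qed
    show "uniform_limit {0..T} (\<lambda>c' t. (mfun a c' t - mfun a c t) / (c' - c)) (resolvent_mult j_fps a c)
        (at c within {c'. (a, c') \<in> param_dom})"
    proof -
      from resolvent_mult_Lipschitz[OF j order_refl, of a c T] obtain M where M: "0 \<le> M"
        "\<And>a' c' t. \<bar>a' - a\<bar> \<le> 1 \<Longrightarrow> \<bar>c' - c\<bar> \<le> 1 \<Longrightarrow> t \<in> {0..T} \<Longrightarrow>
             \<bar>resolvent_mult j_fps a' c' t - resolvent_mult j_fps a c t\<bar> \<le> M * (\<bar>a' - a\<bar> + \<bar>c' - c\<bar>)" by blast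
      have "uniform_limit {0..T} (\<lambda>c' t. (density_series a c' t - density_series a c t) / (c' - c)) (resolvent_mult j_fps a c)
          (at c within {c'. (a, c') \<in> param_dom})"
        by (rule uniform_limit_difference_quotient[where f = "\<lambda>c. density_series a c" and f' = "\<lambda>c. resolvent_mult j_fps a c", OF has_real_derivative_density_series_c M(1)])
          (use M(2)[of a] in simp)
      then show ?thesis
        by (rule uniform_limit_cong[THEN iffD1, rotated -1])
          (auto simp: eventually_at_filter mfun_eq_density_series ac)
    qed
    show "uniform_limit {0..T} (\<lambda>(a', c'). resolvent_mult k_fps a' c') (resolvent_mult k_fps a c) (at (a, c) within param_dom)"
      by (rule resolvent_mult_uniform_limit[OF k order_refl])
    show "uniform_limit {0..T} (\<lambda>(a', c'). resolvent_mult j_fps a' c') (resolvent_mult j_fps a c) (at (a, c) within param_dom)"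
      by (rule resolvent_mult_uniform_limit[OF j order_refl])
  qed
  show ?thesis
    unfolding C1_in_params_loc_unif_def
  proof (rule exI[of _ "resolvent_mult k_fps"], rule exI[of _ "resolvent_mult j_fps"], intro allI impI ballI)
    fix T :: real and p
    assume "p \<in> param_dom"
    moreover obtain a c where p: "p = (a, c)" by (cases p)
    ultimately have "(a, c) \<in> param_dom" by simp
    from 1[OF this, of T] 2[OF this, of T] 3[OF this, of T] 4[OF this, of T]
    show "case p of (a, c) \<Rightarrow>
       uniform_limit {0..T} (\<lambda>a' t. (mfun a' c t - mfun a c t) / (a' - a)) (resolvent_mult k_fps a c)
         (at a within {a'. (a', c) \<in> param_dom}) \<and>
       uniform_limit {0..T} (\<lambda>c' t. (mfun a c' t - mfun a c t) / (c' - c)) (resolvent_mult j_fps a c)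
         (at c within {c'. (a, c') \<in> param_dom}) \<and>
       uniform_limit {0..T} (\<lambda>(a', c'). resolvent_mult k_fps a' c') (resolvent_mult k_fps a c) (at (a, c) within param_dom) \<and>
       uniform_limit {0..T} (\<lambda>(a', c'). resolvent_mult j_fps a' c') (resolvent_mult j_fps a c) (at (a, c) within param_dom)"
      unfolding p prod.case by (intro conjI)
  qed
qed

theorem lemma13:
  "C1_in_params_loc_unif param_dom mfun \<and>
   (\<forall>a c t. (a, c) \<in> param_dom \<and> t \<ge> 0 \<longrightarrow>
      ((\<lambda>a'. mfun a' c t) has_real_derivative (kfun t - conv kfun (mfun a c) t)) (at a) \<and>
      ((\<lambda>c'. mfun a c' t) has_real_derivative (jfun t - conv jfun (mfun a c) t))
        (at c within {0..}) \<and>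
      t * mfun a c t = Qfun a c t - conv (Qfun a c) (mfun a c) t)"
proof (intro conjI allI impI C1_mfun; elim conjE)
  fix a c t :: real
  assume ac: "(a, c) \<in> param_dom" and t: "t \<ge> 0"
  have m: "mfun a c = density_series a c" using mfun_eq_density_series[OF ac] by blast
  have lims: "0 < a" "0 \<le> c" "c < 1" "a + c < 3" using ac by (auto simp: param_dom_def)
  show "((\<lambda>a'. mfun a' c t) has_real_derivative (kfun t - conv kfun (mfun a c) t)) (at a)"
    unfolding m resolvent_mult_k_fps[OF t, symmetric]
  proof (rule DERIV_cong_ev[THEN iffD2, OF refl _ refl has_real_derivative_density_series_a])
    have "eventually (\<lambda>a'. a' \<in> {0<..<3 - c}) (nhds a)"
      using lims by (intro eventually_nhds_in_open) auto
    then show "eventually (\<lambda>a'. mfun a' c t = density_series a' c t) (nhds a)"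
      by eventually_elim (use lims in \<open>auto intro!: mfun_eq_density_series simp: param_dom_def\<close>)
  qed
  show "((\<lambda>c'. mfun a c' t) has_real_derivative (jfun t - conv jfun (mfun a c) t)) (at c within {0..})"
    unfolding m resolvent_mult_j_fps[OF t, symmetric]
  proof (rule has_field_derivative_transform_within[OF has_field_derivative_at_within[OF has_real_derivative_density_series_c]])
    show "0 < min (1 - c) (3 - a - c)" using lims by simp
    show "density_series a c' t = mfun a c' t" if "c' \<in> {0..}" "dist c' c < min (1 - c) (3 - a - c)" for c'
      using that lims by (intro mfun_eq_density_series[symmetric]) (auto simp: param_dom_def dist_real_def)
  qed (use lims in auto)
  show "t * mfun a c t = Qfun a c t - conv (Qfun a c) (mfun a c) t"
    unfolding m by (rule density_series_volterra[OF t])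
qed

end
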